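(* Let $\mathcal{D}\subset\mathbb{R}^d$ be bounded and compact, $\mathcal{H}=L^2(\mathcal{D};\mathbb{R}^d)$, and let $K:\mathcal{D}\times\mathcal{D}\to\mathbb{R}$ be a kernel with $K\in L^2(\mathcal{D}\times\mathcal{D})$. Let $\mathcal{T}=\mathcal{T}_K:\mathcal{H}\to\mathcal{H}$ be the integral operator $(\mathcal{T}_Ku)(x)=\int_{\mathcal{D}}K(x,z)u(z)\,dz$ for any $u\in\mathcal{H}$, assumed non-expansive. Let $\mathcal{S}_K$ be the solution operator of the corresponding Fredholm integral equation $f=g+\mathcal{T}_Kf$ for any $g\in\mathcal{H}$, i.e. $\mathcal{S}_Kg=f$ (it is assumed to exist, so that $I-\mathcal{T}_K$ is invertible and $\mathcal{S}_K=(I-\mathcal{T}_K)^{-1}$). Then, for any $\epsilon_1>0$, $\epsilon_2>0$ and $\epsilon_3>0$, there exists a surrogate model (a neural network) for the kernel, $K_\theta:\mathcal{D}\times\mathcal{D}\to\mathbb{R}$, with parameters $\theta\in\Theta\subset\mathbb{R}^P$, $P\in\mathbb{N}$, such that the following hold. (1) The learned operator $(\mathcal{T}_{K_\theta}u)(x):=\int_{\mathcal{D}}K_\theta(x,z)u(z)\,dz$ satisfies $$\|\mathcal{T}-\mathcal{T}_{K_\theta}\|<\epsilon_1,$$ and the learned solution operator $\mathcal{S}_{K_\theta}$ (the solution operator of $f=g+\mathcal{T}_{K_\theta}f$) satisfies, for any $g\in\mathcal{H}$, $$\|\mathcal{S}_Kg-\mathcal{S}_{K_\theta}g\|_{L^2(\mathcal{D})}<\epsilon_2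 .$$ (2) If $\mathcal{T}$ is a contraction with constant $\rho<1$, then the learned operator $\mathcal{T}_{K_\theta}$ is also contractive, i.e. for any $u,v\in\mathcal{H}$ $$\|\mathcal{T}_{K_\theta}u-\mathcal{T}_{K_\theta}v\|_{L^2(\mathcal{D})}\le\rho_\theta\|u-v\|_{L^2(\mathcal{D})},$$ for some $\rho_\theta<1$. (3) There exists a Fredholm Neural Network $\mathcal{F}(\cdot;\cdot,K_\theta)$, with $M$ hidden layers, such that for all $g\in\mathcal{H}$ $$\|\mathcal{S}_Kg-\mathcal{F}(\cdot;g,K_\theta)\|_{L^2(\mathcal{D})}<\epsilon_3 .$$
   Context: Norms. $\|\cdot\|$ on operators is the operator norm $L^2(\mathcal{D})\to L^2(\mathcal{D})$. An operator $\mathcal{T}:\mathcal{H}\to\mathcal{H}$ is a contraction with constant $q<1$ if $\|\mathcal{T}f_1-\mathcal{T}f_2\|\le q\|f_1-f_2\|$ for all $f_1,f_2\in\mathcal{H}$; it is non-expansive if this holds with $q=1$. A scalar kernel acts on $\mathbb{R}^d$-valued functions componentwise. Neural networks. The class of neural networks used for kernels is $\{N(\cdot,\cdot;\theta):\mathcal{D}\times\mathcal{D}\to\mathbb{R}\,:\,\theta\in\Theta\subset\mathbb{R}^P,\ P\in\mathbb{N}\}$, consisting of networks with input $(x,z)\in\mathcal{D}\times\mathcal{D}$ parameterized by the weights $\theta$. The structure is such that every $N(\cdot,\cdot;\theta)\in L^2(\mathcal{D}\times\mathcal{D})$, and this class is dense in $L^2(\mathcal{D}\times\mathcal{D})$ (standard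 universal approximation). Fredholm Neural Network $\mathcal{F}(\cdot;g,K)$. Given a kernel $K$, a function $g$, a constant $\kappa\in(0,1]$, a number $M$ of layers, and a grid $Z=\{z_1,\dots,z_N\}\subset\mathcal{D}$ with quadrature weight $\Delta z$ (uniform or quasi-Monte Carlo nodes), where the grid is required to contain the evaluation point $x$, the output $\mathcal{F}(x;g,K)$ is computed as follows. The first hidden layer has $N$ nodes with values $v^{(1)}_i=\kappa g(z_i)$. For the layers $m=2,\dots,M-1$, $$v^{(m)}_i=\kappa g(z_i)+\sum_{j=1}^N v^{(m-1)}_j\big(K(z_i,z_j)\,\kappa\,\Delta z+(1-\kappa)\mathbf{1}_{\{z_j=z_i\}}\big),\qquad i=1,\dots,N.$$ The output is $$\mathcal{F}(x;g,K)=\kappa g(x)+\sum_{j=1}^N v^{(M-1)}_j\big(K(x,z_j)\,\kappa\,\Delta z+(1-\kappa)\mathbf{1}_{\{z_j=x\}}\big).$$ Thus the network consists of compositions of affine maps with linear activation and reproduces the discretized Krasnosel'skii--Mann (for $\kappa=1$: Picard) iteration for $f=g+\mathcal{T}_Kf$. Functions are identified with pointwise-defined representatives when evaluated at grid points; for vector-valued $g$ the construction is applied componentwise.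
   Formalization: The solution estimates in (1) and (3) are for all g with ‖g‖ ≤ R, R > 0 arbitrary and given with the ε's (for all g they fail by linearity); in (3) the grid may depend on g (κ, M do not), and the networks of the class are assumed bounded on D×D. *)

theory Defs
  imports "HOL-Analysis.Analysis"
begin

text \<open>
  Lebesgue spaces are represented by pointwise-defined, square-integrable functions; equality in
  the space is equality almost everywhere.
\<close>

definition L2 :: "'a measure \<Rightarrow> ('a \<Rightarrow> 'b::euclidean_space) set" where
  "L2 M = {f \<in> borel_measurable M. integrable M (\<lambda>x. (norm (f x))\<^sup>2)}"

definition L2_norm :: "'a measure \<Rightarrow> ('a \<Rightarrow> 'b::euclidean_space) \<Rightarrow> real" where
  "L2_norm M f = sqrt (LINT x|M. (norm (f x))\<^sup>2)"

abbreviation leb :: "'a::euclidean_space set \<Rightarrow> 'a measure" where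
  "leb D \<equiv> restrict_space lborel D"

abbreviation leb2 :: "'a::euclidean_space set \<Rightarrow> ('a \<times> 'a) measure" where
  "leb2 D \<equiv> leb D \<Otimes>\<^sub>M leb D"

text \<open>
  The supremum is taken in \<^typ>\<open>ennreal\<close>, so that an unbounded operator has norm
  \<^term>\<open>\<infinity> :: ennreal\<close>.
\<close>

definition op_norm ::
    "'a measure \<Rightarrow> (('a \<Rightarrow> 'b::euclidean_space) \<Rightarrow> ('a \<Rightarrow> 'b)) \<Rightarrow> ennreal" where
  "op_norm M A = (SUP u \<in> {u \<in> L2 M. L2_norm M u \<le> 1}. ennreal (L2_norm M (A u)))"

definition lipschitz_L2 ::
    "'a measure \<Rightarrow> real \<Rightarrow> (('a \<Rightarrow> 'b::euclidean_space) \<Rightarrow> ('a \<Rightarrow> 'b)) \<Rightarrow> bool" where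
  "lipschitz_L2 M q A \<longleftrightarrow>
     (\<forall>u \<in> L2 M. \<forall>v \<in> L2 M.
        L2_norm M (\<lambda>x. A u x - A v x) \<le> q * L2_norm M (\<lambda>x. u x - v x))"

definition nonexpansive_L2 ::
    "'a measure \<Rightarrow> (('a \<Rightarrow> 'b::euclidean_space) \<Rightarrow> ('a \<Rightarrow> 'b)) \<Rightarrow> bool" where
  "nonexpansive_L2 M A \<longleftrightarrow> lipschitz_L2 M 1 A"

definition contraction_L2 ::
    "'a measure \<Rightarrow> real \<Rightarrow> (('a \<Rightarrow> 'b::euclidean_space) \<Rightarrow> ('a \<Rightarrow> 'b)) \<Rightarrow> bool" where
  "contraction_L2 M q A \<longleftrightarrow> q < 1 \<and> lipschitz_L2 M q A"

text \<open>A scalar kernel acts on vector-valued functions componentwise.\<close>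

definition int_op ::
    "'a::euclidean_space set \<Rightarrow> ('a \<times> 'a \<Rightarrow> real) \<Rightarrow> ('a \<Rightarrow> 'b::euclidean_space) \<Rightarrow> 'a \<Rightarrow> 'b" where
  "int_op D K u x = (LINT z|leb D. K (x, z) *\<^sub>R u z)"

text \<open>
  \<open>S\<close> sends \<open>g\<close> to the solution \<open>f\<close> of \<open>f = g + \<T>\<^sub>K f\<close>, which exists and is unique in the
  Lebesgue space; that is, \<open>I - \<T>\<^sub>K\<close> is bijective with inverse \<open>S\<close>.
\<close>

definition solution_operator ::
    "'a::euclidean_space set \<Rightarrow> ('a \<times> 'a \<Rightarrow> real) \<Rightarrow>
     (('a \<Rightarrow> 'b::euclidean_space) \<Rightarrow> ('a \<Rightarrow> 'b)) \<Rightarrow> bool" where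
  "solution_operator D K S \<longleftrightarrow>
     (\<forall>g \<in> L2 (leb D).
        S g \<in> L2 (leb D) \<and>
        (AE x in leb D. S g x = g x + int_op D K (S g) x) \<and>
        (\<forall>f \<in> L2 (leb D). (AE x in leb D. f x = g x + int_op D K f x) \<longrightarrow>
           (AE x in leb D. f x = S g x)))"

text \<open>
  A parametrised family \<open>N(\<sqdot>,\<sqdot>;\<theta>)\<close> of kernels, dense in the square-integrable kernels. A weight
  vector \<open>\<theta>\<close> in \<open>\<real>\<^sup>P\<close> is a list of length \<open>P\<close>; different members of \<open>\<Theta>\<close> may have different
  lengths, since an approximating class contains networks of every size.
\<close>

definition kernel_network_class ::
    "'a::euclidean_space set \<Rightarrow> real list set \<Rightarrow> (real list \<Rightarrow> 'a \<times> 'a \<Rightarrow> real) \<Rightarrow> bool" where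
  "kernel_network_class D \<Theta> N \<longleftrightarrow>
     (\<forall>\<theta> \<in> \<Theta>. N \<theta> \<in> L2 (leb2 D)) \<and>
     (\<forall>K \<in> L2 (leb2 D). \<forall>e > 0. \<exists>\<theta> \<in> \<Theta>. L2_norm (leb2 D) (\<lambda>p. K p - N \<theta> p) < e)"

text \<open>
  Fredholm neural network on the grid \<open>Z\<close> with quadrature weight \<open>\<Delta>\<close>. The value at the node \<open>z\<close>
  in the layer \<open>m + 1\<close> is \<open>fnn_hidden \<kappa> \<Delta> Z K g m z\<close>, so that \<open>m = 0\<close> is the first hidden layer
  and the layer \<open>M - 1\<close>, which feeds the output, has index \<open>M - 2\<close>.
\<close>

primrec fnn_hidden ::
    "real \<Rightarrow> real \<Rightarrow> 'a set \<Rightarrow> ('a \<times> 'a \<Rightarrow> real) \<Rightarrow> ('a \<Rightarrow> 'b::euclidean_space) \<Rightarrow>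
     nat \<Rightarrow> 'a \<Rightarrow> 'b" where
  "fnn_hidden \<kappa> \<Delta> Z K g 0 z = \<kappa> *\<^sub>R g z"
| "fnn_hidden \<kappa> \<Delta> Z K g (Suc m) z =
     \<kappa> *\<^sub>R g z +
     (\<Sum>y\<in>Z. (K (z, y) * \<kappa> * \<Delta> + (1 - \<kappa>) * of_bool (y = z)) *\<^sub>R fnn_hidden \<kappa> \<Delta> Z K g m y)"

definition fnn ::
    "real \<Rightarrow> nat \<Rightarrow> real \<Rightarrow> 'a set \<Rightarrow> ('a \<times> 'a \<Rightarrow> real) \<Rightarrow> ('a \<Rightarrow> 'b::euclidean_space) \<Rightarrow>
     'a \<Rightarrow> 'b" where
  "fnn \<kappa> M \<Delta> Z K g x =
     \<kappa> *\<^sub>R g x +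
     (\<Sum>y\<in>Z. (K (x, y) * \<kappa> * \<Delta> + (1 - \<kappa>) * of_bool (y = x)) *\<^sub>R fnn_hidden \<kappa> \<Delta> Z K g (M - 2) y)"

text \<open>
  The grid has to contain the evaluation point, so the point \<open>x\<close> is adjoined to a fixed base grid
  \<open>Z\<close>. The quadrature weight is that of (quasi-)Monte Carlo and uniform rules: the volume of \<open>D\<close>
  divided by the number of nodes.
\<close>

definition fnn_on ::
    "'a::euclidean_space set \<Rightarrow> real \<Rightarrow> nat \<Rightarrow> 'a set \<Rightarrow> ('a \<times> 'a \<Rightarrow> real) \<Rightarrow>
     ('a \<Rightarrow> 'b::euclidean_space) \<Rightarrow> 'a \<Rightarrow> 'b" where
  "fnn_on D \<kappa> M Z K g x =
     fnn \<kappa> M (measure lborel D / real (card (insert x Z))) (insert x Z) K g x"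

end

theory Submission
  imports Defs
begin

text \<open>
  The averaged operator \<open>A = (I + T) / 2\<close> of a non-expansive \<open>T\<close> on a Hilbert space is a strict
  contraction as soon as \<open>I - T\<close> is invertible, because the parallelogram law gives
  \<open>\<parallel>A u\<parallel>\<^sup>2 \<le> \<parallel>u\<parallel>\<^sup>2 - \<parallel>u - T u\<parallel>\<^sup>2 / 4\<close>. This survives a small perturbation of the kernel in the
  Hilbert--Schmidt norm, so the Krasnosel'skii--Mann iteration with \<open>\<kappa> = 1/2\<close> converges geometrically
  for the learned kernel, uniformly for right-hand sides in a ball. For a fixed right-hand side,
  finitely many iterates have to be integrated numerically; nodes which do this well, both in the
  mean over \<open>D\<close> and at the nodes themselves, are found by derandomising Monte Carlo integration.
\<close>

section \<open>Square-integrable functions\<close>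

text \<open>The restriction of the right-hand sides to a ball is forced by linearity: up to null
  sets the difference of two solution operators is linear in \<open>g\<close>, so a bound uniform
  over the whole Lebesgue space would make them equal almost everywhere. The shape of the network
  claim has similar reasons. Depth and relaxation constant can be fixed for the whole ball, because
  the geometric rate is uniform there; but the norm of a square-integrable \<open>g\<close> does not
  control its values on a given finite grid, so the nodes are chosen only after \<open>g\<close>.
  Likewise, closeness in the square-integrable sense says nothing about a kernel on the diagonal, a
  null set on which the network nevertheless evaluates it as soon as the evaluation point is a node;
  a pointwise bound on the learned kernel closes this gap. Relaxation is essential: a non-expansive
  \<open>T\<close> may have -1 in its spectrum, where the Picard iteration oscillates, whereas
  averaging moves -1 to 0.\<close>

definition L2_inner :: "'a measure \<Rightarrow> ('a \<Rightarrow> 'b::euclidean_space) \<Rightarrow> ('a \<Rightarrow> 'b) \<Rightarrow> real" where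
  "L2_inner M f g = (LINT x|M. f x \<bullet> g x)"

lemma L2_borel_measurable: "f \<in> L2 M \<Longrightarrow> f \<in> borel_measurable M"
  by (simp add: L2_def)

lemma L2_integrable_norm_sq: "f \<in> L2 M \<Longrightarrow> integrable M (\<lambda>x. (norm (f x))\<^sup>2)"
  by (simp add: L2_def)

lemma L2_zero [simp]: "(\<lambda>x. 0) \<in> L2 M"
  by (simp add: L2_def)

lemma L2_scaleR: "f \<in> L2 M \<Longrightarrow> (\<lambda>x. c *\<^sub>R f x) \<in> L2 M"
  by (auto simp: L2_def power_mult_distrib)

lemma L2_norm_fun: "f \<in> L2 M \<Longrightarrow> (\<lambda>x. norm (f x)) \<in> L2 M"
  by (auto simp: L2_def)

lemma norm_add_sq_le: "(norm (a + b))\<^sup>2 \<le> 2 * (norm a)\<^sup>2 + 2 * (norm b)\<^sup>2"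
  for a b :: "'b::real_normed_vector"
proof -
  have "(norm (a + b))\<^sup>2 \<le> (norm a + norm b)\<^sup>2"
    by (intro power_mono norm_triangle_ineq) auto
  also have "\<dots> \<le> 2 * (norm a)\<^sup>2 + 2 * (norm b)\<^sup>2"
    using zero_le_power2[of "norm a - norm b"] by (simp add: power2_eq_square algebra_simps)
  finally show ?thesis .
qed

lemma L2_add:
  assumes "f \<in> L2 M" "g \<in> L2 M"
  shows "(\<lambda>x. f x + g x) \<in> L2 M"
proof -
  note [measurable] = L2_borel_measurable[OF assms(1)] L2_borel_measurable[OF assms(2)]
  have "integrable M (\<lambda>x. 2 * (norm (f x))\<^sup>2 + 2 * (norm (g x))\<^sup>2)"
    using assms by (simp add: L2_integrable_norm_sq)
  then have "integrable M (\<lambda>x. (norm (f x + g x))\<^sup>2)"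
    by (rule Bochner_Integration.integrable_bound) (auto simp: norm_add_sq_le)
  then show ?thesis
    by (simp add: L2_def)
qed

lemma L2_uminus: "f \<in> L2 M \<Longrightarrow> (\<lambda>x. - f x) \<in> L2 M"
  using L2_scaleR[of f M "-1"] by simp

lemma L2_diff: "f \<in> L2 M \<Longrightarrow> g \<in> L2 M \<Longrightarrow> (\<lambda>x. f x - g x) \<in> L2 M"
  using L2_add[OF _ L2_uminus, of f M g] by simp

lemma L2_sum: "(\<And>i. i \<in> I \<Longrightarrow> f i \<in> L2 M) \<Longrightarrow> (\<lambda>x. \<Sum>i\<in>I. f i x) \<in> L2 M"
  by (induction I rule: infinite_finite_induct) (auto intro: L2_add)

lemma L2_bound:
  assumes "g \<in> L2 M" "f \<in> borel_measurable M" "AE x in M. norm (f x) \<le> norm (g x)"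
  shows "f \<in> L2 M"
proof -
  note [measurable] = assms(2)
  have "integrable M (\<lambda>x. (norm (f x))\<^sup>2)"
    by (rule Bochner_Integration.integrable_bound[OF L2_integrable_norm_sq[OF assms(1)]])
      (use assms(3) in \<open>auto intro: power_mono\<close>)
  then show ?thesis
    by (simp add: L2_def)
qed

lemma L2_cong_AE:
  assumes "g \<in> L2 M" "f \<in> borel_measurable M" "AE x in M. f x = g x"
  shows "f \<in> L2 M"
  by (rule L2_bound[OF assms(1,2)]) (use assms(3) in auto)

lemma L2_inner_integrable:
  assumes "f \<in> L2 M" "g \<in> L2 M"
  shows "integrable M (\<lambda>x. f x \<bullet> g x)"
proof -
  note [measurable] = L2_borel_measurable[OF assms(1)] L2_borel_measurable[OF assms(2)]
  have int: "integrable M (\<lambda>x. (norm (f x))\<^sup>2 + (norm (g x))\<^sup>2)"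
    using assms by (simp add: L2_integrable_norm_sq)
  have le: "norm (f x \<bullet> g x) \<le> norm ((norm (f x))\<^sup>2 + (norm (g x))\<^sup>2)" for x
  proof -
    have "\<bar>f x \<bullet> g x\<bar> \<le> norm (f x) * norm (g x)"
      by (rule Cauchy_Schwarz_ineq2)
    also have "\<dots> \<le> (norm (f x))\<^sup>2 + (norm (g x))\<^sup>2"
      using sum_squares_bound[of "norm (f x)" "norm (g x)"]
        mult_nonneg_nonneg[OF norm_ge_zero norm_ge_zero, of "f x" "g x"] by linarith
    finally show ?thesis
      by simp
  qed
  show ?thesis
    by (rule Bochner_Integration.integrable_bound[OF int _ AE_I2[OF le]]) measurable
qed

lemma L2_norm_nonneg [simp]: "0 \<le> L2_norm M f"
  by (simp add: L2_norm_def)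

lemma L2_norm_sq: "(L2_norm M f)\<^sup>2 = (LINT x|M. (norm (f x))\<^sup>2)"
  by (simp add: L2_norm_def)

lemma L2_norm_sq_inner: "(L2_norm M f)\<^sup>2 = L2_inner M f f"
  by (simp add: L2_norm_sq L2_inner_def power2_norm_eq_inner)

lemma L2_norm_norm: "L2_norm M (\<lambda>x. norm (f x)) = L2_norm M f"
  by (simp add: L2_norm_def)

lemma L2_norm_zero [simp]: "L2_norm M (\<lambda>x. 0) = 0"
  by (simp add: L2_norm_def)

lemma L2_norm_cong_AE:
  assumes "f \<in> borel_measurable M" "g \<in> borel_measurable M" "AE x in M. f x = g x"
  shows "L2_norm M f = L2_norm M g"
proof -
  note [measurable] = assms(1,2)
  have "(LINT x|M. (norm (f x))\<^sup>2) = (LINT x|M. (norm (g x))\<^sup>2)"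
    by (rule integral_cong_AE) (use assms(3) in auto)
  then show ?thesis
    by (simp add: L2_norm_def)
qed

lemma L2_norm_mono_AE:
  assumes "g \<in> L2 M" "f \<in> borel_measurable M" "AE x in M. norm (f x) \<le> norm (g x)"
  shows "L2_norm M f \<le> L2_norm M g"
proof -
  have "AE x in M. (norm (f x))\<^sup>2 \<le> (norm (g x))\<^sup>2"
    using assms(3) by eventually_elim (simp add: power_mono)
  then have "(LINT x|M. (norm (f x))\<^sup>2) \<le> (LINT x|M. (norm (g x))\<^sup>2)"
    by (intro integral_mono_AE L2_integrable_norm_sq L2_bound[OF assms] assms(1))
  then show ?thesis
    by (simp add: L2_norm_def)
qed

lemma L2_norm_eq_0_AE:
  assumes "f \<in> L2 M" "L2_norm M f = 0"
  shows "AE x in M. f x = 0"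
proof -
  have "(LINT x|M. (norm (f x))\<^sup>2) = 0"
    using assms(2) by (simp add: L2_norm_def)
  then have "AE x in M. (norm (f x))\<^sup>2 = 0"
    using integral_nonneg_eq_0_iff_AE[OF L2_integrable_norm_sq[OF assms(1)]] by simp
  then show ?thesis
    by simp
qed

lemma L2_norm_scaleR: "L2_norm M (\<lambda>x. c *\<^sub>R f x) = \<bar>c\<bar> * L2_norm M f"
  by (simp add: L2_norm_def power_mult_distrib real_sqrt_mult)

lemma L2_norm_minus_commute: "L2_norm M (\<lambda>x. f x - g x) = L2_norm M (\<lambda>x. g x - f x)"
  by (simp add: L2_norm_def norm_minus_commute)

lemma L2_inner_commute: "L2_inner M f g = L2_inner M g f"
  by (simp add: L2_inner_def inner_commute)

lemma L2_inner_add_right: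
  assumes "f \<in> L2 M" "g \<in> L2 M" "h \<in> L2 M"
  shows "L2_inner M f (\<lambda>x. g x + h x) = L2_inner M f g + L2_inner M f h"
  using assms by (simp add: L2_inner_def inner_add_right L2_inner_integrable)

lemma L2_inner_diff_right:
  assumes "f \<in> L2 M" "g \<in> L2 M" "h \<in> L2 M"
  shows "L2_inner M f (\<lambda>x. g x - h x) = L2_inner M f g - L2_inner M f h"
  using assms by (simp add: L2_inner_def inner_diff_right L2_inner_integrable)

lemma L2_inner_scaleR_right: "L2_inner M f (\<lambda>x. c *\<^sub>R g x) = c * L2_inner M f g"
  by (simp add: L2_inner_def)

lemma L2_inner_cong_AE:
  assumes "f \<in> borel_measurable M" "g \<in> borel_measurable M" "h \<in> borel_measurable M"
    and "AE x in M. g x = h x"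
  shows "L2_inner M f g = L2_inner M f h"
proof -
  note [measurable] = assms(1-3)
  show ?thesis
    unfolding L2_inner_def
  proof (rule integral_cong_AE)
    show "AE x in M. f x \<bullet> g x = f x \<bullet> h x"
      using assms(4) by eventually_elim simp
  qed measurable
qed

lemma L2_norm_add_sq:
  assumes "f \<in> L2 M" "g \<in> L2 M"
  shows "(L2_norm M (\<lambda>x. f x + g x))\<^sup>2 = (L2_norm M f)\<^sup>2 + 2 * L2_inner M f g + (L2_norm M g)\<^sup>2"
proof -
  have "(LINT x|M. (norm (f x + g x))\<^sup>2)
      = (LINT x|M. (norm (f x))\<^sup>2 + 2 * (f x \<bullet> g x) + (norm (g x))\<^sup>2)"
    by (simp add: power2_norm_eq_inner inner_add_left inner_add_right inner_commute
        ab_semigroup_add_class.add_ac)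
  also have "\<dots> = (LINT x|M. (norm (f x))\<^sup>2) + 2 * L2_inner M f g + (LINT x|M. (norm (g x))\<^sup>2)"
    using assms by (simp add: L2_inner_def L2_integrable_norm_sq L2_inner_integrable)
  finally show ?thesis
    by (simp add: L2_norm_sq)
qed

lemma L2_norm_diff_sq:
  assumes "f \<in> L2 M" "g \<in> L2 M"
  shows "(L2_norm M (\<lambda>x. f x - g x))\<^sup>2 = (L2_norm M f)\<^sup>2 - 2 * L2_inner M f g + (L2_norm M g)\<^sup>2"
  using L2_norm_add_sq[OF assms(1) L2_scaleR[OF assms(2), of "-1"]]
  by (simp only: L2_inner_scaleR_right L2_norm_scaleR) simp

lemma L2_Cauchy_Schwarz:
  assumes "f \<in> L2 M" "g \<in> L2 M"
  shows "\<bar>L2_inner M f g\<bar> \<le> L2_norm M f * L2_norm M g"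
proof -
  let ?a = "L2_norm M f" and ?b = "L2_norm M g" and ?i = "L2_inner M f g"
  have "L2_inner M (\<lambda>x. s *\<^sub>R f x) (\<lambda>x. t *\<^sub>R g x) = s * t * ?i" for s t
    by (simp add: L2_inner_def)
  then have quad: "0 \<le> s\<^sup>2 * ?a\<^sup>2 + 2 * (s * t * ?i) + t\<^sup>2 * ?b\<^sup>2" for s t
    using zero_le_power2[of "L2_norm M (\<lambda>x. s *\<^sub>R f x + t *\<^sub>R g x)"]
      L2_norm_add_sq[OF L2_scaleR[OF assms(1), of s] L2_scaleR[OF assms(2), of t]]
    by (simp add: L2_norm_scaleR power_mult_distrib)
  show ?thesis
  proof (cases "?b = 0")
    case True
    note [measurable] = L2_borel_measurable[OF assms(1)] L2_borel_measurable[OF assms(2)]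
    have "L2_inner M f g = L2_inner M f (\<lambda>x. 0)"
      by (rule L2_inner_cong_AE) (use L2_norm_eq_0_AE[OF assms(2) True] in auto)
    then show ?thesis
      using True by (simp add: L2_inner_def)
  next
    case False
    then have b: "?b > 0"
      using L2_norm_nonneg[of M g] by linarith
    \<comment> \<open>With s = \<open>?b\<^sup>2\<close> and t = \<open>- ?i\<close> the vector s f
      + t g is \<open>?b\<^sup>2\<close> times the component of f orthogonal to g, where the
      quadratic form is smallest.\<close>
    have "?i\<^sup>2 * ?b\<^sup>2 \<le> ?a\<^sup>2 * ?b\<^sup>2 * ?b\<^sup>2"
      using quad[of "?b\<^sup>2" "- ?i"] by (simp add: power2_eq_square algebra_simps)
    then have "?i\<^sup>2 \<le> (?a * ?b)\<^sup>2"
      using b by (simp add: power_mult_distrib)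
    then show ?thesis
      using abs_le_square_iff[of ?i "?a * ?b"] by simp
  qed
qed

lemma L2_norm_triangle:
  assumes "f \<in> L2 M" "g \<in> L2 M"
  shows "L2_norm M (\<lambda>x. f x + g x) \<le> L2_norm M f + L2_norm M g"
proof (rule power2_le_imp_le)
  show "(L2_norm M (\<lambda>x. f x + g x))\<^sup>2 \<le> (L2_norm M f + L2_norm M g)\<^sup>2"
    using L2_norm_add_sq[OF assms] L2_Cauchy_Schwarz[OF assms] by (simp add: power2_sum)
qed simp

lemma L2_norm_triangle_diff:
  assumes "f \<in> L2 M" "g \<in> L2 M" "h \<in> L2 M"
  shows "L2_norm M (\<lambda>x. f x - h x) \<le> L2_norm M (\<lambda>x. f x - g x) + L2_norm M (\<lambda>x. g x - h x)"
  using L2_norm_triangle[OF L2_diff[OF assms(1,2)] L2_diff[OF assms(2,3)]] by simp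

lemma L2_norm_sum_le:
  assumes "finite I" "\<And>i. i \<in> I \<Longrightarrow> f i \<in> L2 M"
  shows "L2_norm M (\<lambda>x. \<Sum>i\<in>I. f i x) \<le> (\<Sum>i\<in>I. L2_norm M (f i))"
  using assms
proof (induction I rule: finite_induct)
  case (insert i I)
  have "L2_norm M (\<lambda>x. f i x + (\<Sum>i\<in>I. f i x)) \<le> L2_norm M (f i) + L2_norm M (\<lambda>x. \<Sum>i\<in>I. f i x)"
    by (intro L2_norm_triangle L2_sum) (use insert in auto)
  then show ?case
    using insert by auto
qed simp

section \<open>Completeness along sequences with geometric increments\<close>

lemma L2_norm_diff_telescope:
  assumes L2: "\<And>n. G n \<in> L2 M" and "m \<le> n"
  shows "L2_norm M (\<lambda>x. G n x - G m x) \<le> (\<Sum>k=m..<n. L2_norm M (\<lambda>x. G (Suc k) x - G k x))"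
  using \<open>m \<le> n\<close>
proof (induction n rule: dec_induct)
  case (step n)
  then show ?case
    using L2_norm_triangle_diff[OF L2[of "Suc n"] L2[of n] L2[of m]] by simp
qed simp

lemma sum_geometric_le:
  fixes q :: real
  assumes "0 < q" "q < 1" "m \<le> n"
  shows "(\<Sum>k=m..<n. q ^ k) \<le> q ^ m / (1 - q)"
proof -
  have "(\<Sum>k=m..<n. q ^ k) * (1 - q) = q ^ m - q ^ n"
    using \<open>m \<le> n\<close> by (induction n rule: dec_induct) (auto simp: distrib_right, auto simp: algebra_simps)
  then have "(\<Sum>k=m..<n. q ^ k) = (q ^ m - q ^ n) / (1 - q)"
    using assms by (simp add: eq_divide_eq)
  then show ?thesis
    using assms by (simp add: divide_right_mono)
qed

text \<open>
  The increments are summable almost everywhere since \<open>a \<le> q\<^sup>k + a\<^sup>2 / q\<^sup>k\<close>; the error bound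
  passes to the limit by Fatou's lemma.
\<close>

lemma L2_complete_geometric:
  fixes G :: "nat \<Rightarrow> 'a \<Rightarrow> 'b::euclidean_space"
  assumes L2: "\<And>n. G n \<in> L2 M"
    and step: "\<And>n. L2_norm M (\<lambda>x. G (Suc n) x - G n x) \<le> C * q ^ n"
    and q: "0 < q" "q < 1"
  obtains g where "g \<in> L2 M" "\<And>n. L2_norm M (\<lambda>x. g x - G n x) \<le> C * q ^ n / (1 - q)"
proof -
  note [measurable] = L2_borel_measurable[OF L2]
  have C: "0 \<le> C"
    using order_trans[OF L2_norm_nonneg step[of 0]] by simp
  define d where "d k x = (norm (G (Suc k) x - G k x))\<^sup>2" for k x
  have d_int: "integrable M (d k)" for k
    unfolding d_def by (intro L2_integrable_norm_sq L2_diff L2)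
  have d_nonneg: "0 \<le> d k x" for k x
    by (simp add: d_def)
  have d_meas [measurable]: "d k \<in> borel_measurable M" for k
    unfolding d_def by measurable
  have d_le: "(LINT x|M. d k x) / q ^ k \<le> C\<^sup>2 * q ^ k" for k
  proof -
    have "(LINT x|M. d k x) = (L2_norm M (\<lambda>x. G (Suc k) x - G k x))\<^sup>2"
      by (simp add: d_def L2_norm_sq)
    also have "\<dots> \<le> (C * q ^ k)\<^sup>2"
      by (intro power_mono step) simp
    finally show ?thesis
      using q by (simp add: field_simps power2_eq_square)
  qed
  \<comment> \<open>Even after division by q^k the squared increments have integrals at most C^2
    q^k. The weighted series therefore has a finite integral, and so is finite almost
    everywhere.\<close>
  have "(\<integral>\<^sup>+x. (\<Sum>k. ennreal (d k x / q ^ k)) \<partial>M) = (\<Sum>k. \<integral>\<^sup>+x. ennreal (d k x / q ^ k) \<partial>M)"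
    by (rule nn_integral_suminf) measurable
  also have "\<dots> = (\<Sum>k. ennreal ((LINT x|M. d k x) / q ^ k))"
  proof (intro arg_cong[where f = suminf] ext)
    fix k
    show "(\<integral>\<^sup>+x. ennreal (d k x / q ^ k) \<partial>M) = ennreal ((LINT x|M. d k x) / q ^ k)"
      using nn_integral_eq_integral[of M "\<lambda>x. d k x / q ^ k"] q d_int[of k] d_nonneg by simp
  qed
  also have "\<dots> \<le> (\<Sum>k. ennreal (C\<^sup>2 * q ^ k))"
    by (intro suminf_le ennreal_leI d_le) auto
  also have "\<dots> = ennreal (\<Sum>k. C\<^sup>2 * q ^ k)"
    using q by (intro suminf_ennreal2 summable_mult summable_geometric) auto
  also have "\<dots> < \<infinity>"
    by simp
  finally have "AE x in M. (\<Sum>k. ennreal (d k x / q ^ k)) \<noteq> \<infinity>"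
    by (intro nn_integral_noteq_infinite) auto
  then have "AE x in M. convergent (\<lambda>n. G n x)"
  proof eventually_elim
    case (elim x)
    have "summable (\<lambda>k. d k x / q ^ k)"
      by (rule summable_suminf_not_top) (use elim q d_nonneg in auto)
    then have "summable (\<lambda>k. q ^ k + d k x / q ^ k)"
      using q by (intro summable_add summable_geometric) auto
    then have "summable (\<lambda>k. G (Suc k) x - G k x)"
    proof (rule summable_comparison_test'[where N = 0])
      fix k
      have "0 \<le> (q ^ k - norm (G (Suc k) x - G k x))\<^sup>2"
        by simp
      then have "2 * q ^ k * norm (G (Suc k) x - G k x) \<le> (q ^ k)\<^sup>2 + d k x"
        by (simp add: d_def power2_diff)
      moreover have "0 \<le> q ^ k * norm (G (Suc k) x - G k x)"
        using q by simp
      ultimately have "q ^ k * norm (G (Suc k) x - G k x) \<le> (q ^ k)\<^sup>2 + d k x"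
        by linarith
      then have "norm (G (Suc k) x - G k x) * q ^ k \<le> (q ^ k + d k x / q ^ k) * q ^ k"
        using q by (simp add: algebra_simps power2_eq_square)
      then show "norm (G (Suc k) x - G k x) \<le> q ^ k + d k x / q ^ k"
        using q by simp
    qed
    then have "convergent (\<lambda>n. \<Sum>k<n. G (Suc k) x - G k x)"
      by (simp add: summable_iff_convergent)
    then have "convergent (\<lambda>n. G n x - G 0 x)"
      using sum_lessThan_telescope[of "\<lambda>k. G k x"] by simp
    then have "convergent (\<lambda>n. G n x - G 0 x + G 0 x)"
      by (intro convergent_add convergent_const)
    then show ?case
      by simp
  qed
  note conv = this
  \<comment> \<open>Where the sequence diverges, on a null set by \<open>conv\<close>,
    \<open>lim\<close> returns one fixed unspecified value.\<close>
  define g where "g x = lim (\<lambda>n. G n x)" for x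
  have g_meas [measurable]: "g \<in> borel_measurable M"
    unfolding g_def by measurable
  have fatou: "(\<integral>\<^sup>+x. ennreal ((norm (g x - G n x))\<^sup>2) \<partial>M) \<le> ennreal ((C * q ^ n / (1 - q))\<^sup>2)" for n
  proof -
    have "(\<integral>\<^sup>+x. ennreal ((norm (g x - G n x))\<^sup>2) \<partial>M)
        = (\<integral>\<^sup>+x. liminf (\<lambda>k. ennreal ((norm (G k x - G n x))\<^sup>2)) \<partial>M)"
    proof (rule nn_integral_cong_AE, use conv in eventually_elim)
      case (elim x)
      then have "(\<lambda>k. G k x) \<longlonglongrightarrow> g x"
        by (simp add: g_def convergent_LIMSEQ_iff)
      then have "(\<lambda>k. ennreal ((norm (G k x - G n x))\<^sup>2)) \<longlonglongrightarrow> ennreal ((norm (g x - G n x))\<^sup>2)"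
        by (intro tendsto_intros)
      then show ?case
        by (metis lim_imp_Liminf sequentially_bot)
    qed
    also have "\<dots> \<le> liminf (\<lambda>k. \<integral>\<^sup>+x. ennreal ((norm (G k x - G n x))\<^sup>2) \<partial>M)"
      by (rule nn_integral_liminf) measurable
    also have "\<dots> \<le> ennreal ((C * q ^ n / (1 - q))\<^sup>2)"
    proof (rule Liminf_le)
      show "\<forall>\<^sub>F k in sequentially. (\<integral>\<^sup>+x. ennreal ((norm (G k x - G n x))\<^sup>2) \<partial>M)
          \<le> ennreal ((C * q ^ n / (1 - q))\<^sup>2)"
      proof (rule eventually_sequentiallyI[of n])
        fix k assume "n \<le> k"
        have "L2_norm M (\<lambda>x. G k x - G n x) \<le> (\<Sum>j=n..<k. C * q ^ j)"
          by (rule order_trans[OF L2_norm_diff_telescope[OF L2 \<open>n \<le> k\<close>] sum_mono]) (rule step)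
        also have "\<dots> \<le> C * (q ^ n / (1 - q))"
          unfolding sum_distrib_left[symmetric]
          by (intro mult_left_mono sum_geometric_le q C \<open>n \<le> k\<close>)
        finally have "(L2_norm M (\<lambda>x. G k x - G n x))\<^sup>2 \<le> (C * q ^ n / (1 - q))\<^sup>2"
          by (intro power_mono) simp_all
        then show "(\<integral>\<^sup>+x. ennreal ((norm (G k x - G n x))\<^sup>2) \<partial>M) \<le> ennreal ((C * q ^ n / (1 - q))\<^sup>2)"
          by (subst nn_integral_eq_integral)
            (auto simp: L2_norm_sq intro!: L2_integrable_norm_sq L2_diff L2)
      qed
    qed simp
    finally show ?thesis .
  qed
  have diff_L2: "(\<lambda>x. g x - G n x) \<in> L2 M" for n
  proof -
    have "integrable M (\<lambda>x. (norm (g x - G n x))\<^sup>2)"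
      by (rule integrableI_bounded) (use fatou[of n] in \<open>auto intro: le_less_trans\<close>)
    then show ?thesis
      by (simp add: L2_def)
  qed
  show ?thesis
  proof
    show "g \<in> L2 M"
      using L2_add[OF diff_L2[of 0] L2[of 0]] by simp
    fix n
    have "ennreal ((L2_norm M (\<lambda>x. g x - G n x))\<^sup>2) \<le> ennreal ((C * q ^ n / (1 - q))\<^sup>2)"
      unfolding L2_norm_sq
      by (subst nn_integral_eq_integral[symmetric])
        (use fatou diff_L2 in \<open>auto intro: L2_integrable_norm_sq\<close>)
    then have "(L2_norm M (\<lambda>x. g x - G n x))\<^sup>2 \<le> (C * q ^ n / (1 - q))\<^sup>2"
      by simp
    then show "L2_norm M (\<lambda>x. g x - G n x) \<le> C * q ^ n / (1 - q)"
      by (rule power2_le_imp_le) (use C q in simp)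
  qed
qed

section \<open>A spectral gap for averaged operators\<close>

text \<open>
  The gap of \<open>T\<close> is read off its adjoint: were \<open>I - T'\<close> not bounded below, the gliding hump of
  the uniform boundedness principle would produce a right-hand side for which \<open>f = g + T f\<close> has
  no solution. The parallelogram law then turns the lower bound for \<open>I - T'\<close> into an upper bound
  for \<open>I + T'\<close>, which passes to \<open>I + T\<close> by duality.
\<close>

lemma L2_adjoint_bounded_below:
  fixes T T' :: "('a \<Rightarrow> 'b::euclidean_space) \<Rightarrow> ('a \<Rightarrow> 'b)"
  assumes T: "\<And>u. u \<in> L2 M \<Longrightarrow> T u \<in> L2 M" and T': "\<And>u. u \<in> L2 M \<Longrightarrow> T' u \<in> L2 M"
    and adj: "\<And>u w. u \<in> L2 M \<Longrightarrow> w \<in> L2 M \<Longrightarrow> L2_inner M (T u) w = L2_inner M u (T' w)"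
    and solv: "\<And>g. g \<in> L2 M \<Longrightarrow> \<exists>f\<in>L2 M. AE x in M. f x = g x + T f x"
  obtains c where "c > 0" "\<And>w. w \<in> L2 M \<Longrightarrow> c * L2_norm M w \<le> L2_norm M (\<lambda>x. w x - T' w x)"
proof (rule ccontr)
  note thesis = that
  assume no: "\<not> thesis"
  \<comment> \<open>Each constant (1/4)^n fails as a lower bound, which yields almost fixed vectors
    of \<open>T'\<close>. The ratio 1/4 is taken smaller than the ratio 1/3 of the humps built
    below.\<close>
  have "\<exists>w\<in>L2 M. L2_norm M (\<lambda>x. w x - T' w x) < (1/4)^n * L2_norm M w" for n :: nat
  proof (rule ccontr)
    assume "\<not> (\<exists>w\<in>L2 M. L2_norm M (\<lambda>x. w x - T' w x) < (1/4)^n * L2_norm M w)"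
    then have "thesis"
      by (intro thesis[of "(1/4)^n"]) (auto simp: not_less)
    with no show False ..
  qed
  then obtain w where w: "\<And>n. w n \<in> L2 M"
    and small: "\<And>n. L2_norm M (\<lambda>x. w n x - T' (w n) x) < (1/4)^n * L2_norm M (w n)"
    by metis
  have pos: "L2_norm M (w n) > 0" for n
  proof -
    have "0 < (1/4)^n * L2_norm M (w n)"
      by (rule le_less_trans[OF L2_norm_nonneg small])
    then show ?thesis
      by (simp add: zero_less_mult_iff)
  qed
  define e where "e n x = (1 / L2_norm M (w n)) *\<^sub>R w n x" for n x
  have e: "e n \<in> L2 M" for n
    unfolding e_def by (intro L2_scaleR w)
  have "L2_norm M (e n) = 1" for n
    unfolding e_def L2_norm_scaleR using pos[of n] by simp
  then have ee: "L2_norm M (e n) = 1" "L2_inner M (e n) (e n) = 1" for n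
    using L2_norm_sq_inner[of M "e n"] by simp_all
  \<comment> \<open>For g = f - T f the operator moves to the other factor: the pairing of
    \<open>e n\<close> with g is that of (I - T') (\<open>e n\<close>) with f. A solvable g is thus
    nearly orthogonal to the almost fixed vectors.\<close>
  have upper: "\<bar>L2_inner M (e n) g\<bar> \<le> (1/4)^n * L2_norm M f"
    if g: "g \<in> L2 M" and f: "f \<in> L2 M" and eq: "AE x in M. f x = g x + T f x" for f g n
  proof -
    note L2s = L2_borel_measurable[OF g] L2_borel_measurable[OF w[of n]]
      L2_borel_measurable[OF L2_diff[OF f T[OF f]]]
    have "L2_inner M (w n) g = L2_inner M (w n) (\<lambda>x. f x - T f x)"
      by (rule L2_inner_cong_AE) (use eq L2s in auto)
    also have "\<dots> = L2_inner M f (w n) - L2_inner M f (T' (w n))"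
      unfolding L2_inner_diff_right[OF w f T[OF f]] using adj[OF f w]
      by (simp only: L2_inner_commute[of M "w n"])
    also have "\<dots> = L2_inner M f (\<lambda>x. w n x - T' (w n) x)"
      by (simp add: L2_inner_diff_right f w T')
    finally have "\<bar>L2_inner M (w n) g\<bar> \<le> L2_norm M f * L2_norm M (\<lambda>x. w n x - T' (w n) x)"
      using L2_Cauchy_Schwarz[OF f L2_diff[OF w T'[OF w]]] by simp
    also have "\<dots> \<le> L2_norm M f * ((1/4)^n * L2_norm M (w n))"
      using small[of n] by (intro mult_left_mono) auto
    finally have "\<bar>L2_inner M (w n) g\<bar> / L2_norm M (w n) \<le> (1/4)^n * L2_norm M f"
      using pos[of n] by (simp add: divide_le_eq mult_ac)
    moreover have "L2_inner M (e n) g = L2_inner M (w n) g / L2_norm M (w n)"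
      unfolding L2_inner_commute[of M _ g] e_def L2_inner_scaleR_right by simp
    ultimately show ?thesis
      using pos[of n] by simp
  qed
  \<comment> \<open>The sign prevents the n-th hump from cancelling what the partial sum already has
    along \<open>e n\<close>. Later humps add up to at most (1/3)^(n+1) / (1 - 1/3), half of this
    one, so half of it survives in the limit.\<close>
  define s :: "nat \<Rightarrow> ('a \<Rightarrow> 'b) \<Rightarrow> real"
    where "s n u = (if L2_inner M (e n) u \<ge> 0 then 1 else - 1)" for n u
  define G where "G = rec_nat (\<lambda>x. 0) (\<lambda>n u x. u x + (s n u * (1/3)^n) *\<^sub>R e n x)"
  have G_Suc: "G (Suc n) = (\<lambda>x. G n x + (s n (G n) * (1/3)^n) *\<^sub>R e n x)" for n
    by (simp add: G_def)
  have G: "G n \<in> L2 M" for n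
    by (induction n) (auto simp: G_def intro!: L2_add L2_scaleR e)
  have s_abs: "\<bar>s n u\<bar> = 1" for n u
    by (simp add: s_def)
  have step: "L2_norm M (\<lambda>x. G (Suc n) x - G n x) \<le> 1 * (1/3)^n" for n
    by (simp add: G_Suc L2_norm_scaleR ee abs_mult s_abs)
  obtain g where g: "g \<in> L2 M"
    and g_le: "\<And>n. L2_norm M (\<lambda>x. g x - G n x) \<le> 1 * (1/3)^n / (1 - 1/3)"
    by (rule L2_complete_geometric[OF G step _ _ that]) simp_all
  have lower: "(1/3)^n / 2 \<le> \<bar>L2_inner M (e n) g\<bar>" for n
  proof -
    have "L2_inner M (e n) (G (Suc n)) = L2_inner M (e n) (G n) + s n (G n) * (1/3)^n"
      unfolding G_Suc by (simp add: L2_inner_add_right L2_scaleR e G L2_inner_scaleR_right ee)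
    then have "(1/3)^n \<le> \<bar>L2_inner M (e n) (G (Suc n))\<bar>"
      by (auto simp: s_def)
    moreover have "\<bar>L2_inner M (e n) (\<lambda>x. g x - G (Suc n) x)\<bar> \<le> (1/3)^n / 2"
      using L2_Cauchy_Schwarz[OF e L2_diff[OF g G], of n "Suc n"] g_le[of "Suc n"] by (simp add: ee)
    ultimately show ?thesis
      unfolding L2_inner_diff_right[OF e g G] by linarith
  qed
  obtain f where f: "f \<in> L2 M" "AE x in M. f x = g x + T f x"
    using solv[OF g] by blast
  obtain n where n: "2 * L2_norm M f < (4/3)^n"
    using real_arch_pow[of "4/3" "2 * L2_norm M f"] by auto
  have "(1/3)^n / 2 \<le> (1/4)^n * L2_norm M f"
    using lower upper[OF g f] by (rule order_trans)
  then have "(4/3)^n \<le> 2 * L2_norm M f"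
    by (simp add: power_divide field_simps)
  with n show False
    by simp
qed

lemma L2_averaged_operator_gap:
  fixes T T' :: "('a \<Rightarrow> 'b::euclidean_space) \<Rightarrow> ('a \<Rightarrow> 'b)"
  assumes T: "\<And>u. u \<in> L2 M \<Longrightarrow> T u \<in> L2 M" and T': "\<And>u. u \<in> L2 M \<Longrightarrow> T' u \<in> L2 M"
    and adj: "\<And>u w. u \<in> L2 M \<Longrightarrow> w \<in> L2 M \<Longrightarrow> L2_inner M (T u) w = L2_inner M u (T' w)"
    and nonexp: "\<And>u. u \<in> L2 M \<Longrightarrow> L2_norm M (T u) \<le> L2_norm M u"
    and solv: "\<And>g. g \<in> L2 M \<Longrightarrow> \<exists>f\<in>L2 M. AE x in M. f x = g x + T f x"
  obtains q where "0 \<le> q" "q < 1"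
    "\<And>u. u \<in> L2 M \<Longrightarrow> L2_norm M (\<lambda>x. (1/2) *\<^sub>R (u x + T u x)) \<le> q * L2_norm M u"
proof -
  obtain c0 where c0: "c0 > 0"
    and c0_le: "\<And>w. w \<in> L2 M \<Longrightarrow> c0 * L2_norm M w \<le> L2_norm M (\<lambda>x. w x - T' w x)"
    using L2_adjoint_bounded_below[OF T T' adj solv] by blast
  define c where "c = min c0 1"
  have c: "0 < c" "c \<le> 1"
    using c0 by (auto simp: c_def)
  have c_le: "c * L2_norm M w \<le> L2_norm M (\<lambda>x. w x - T' w x)" if "w \<in> L2 M" for w
    using c0_le[OF that] mult_right_mono[of c c0 "L2_norm M w"] by (simp add: c_def)
  have cancel: "a \<le> b" if "a\<^sup>2 \<le> b * a" "0 \<le> a" "0 \<le> b" for a b :: real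
    using that by (cases "a = 0") (auto simp: power2_eq_square)
  \<comment> \<open>Non-expansiveness passes to the adjoint: the squared norm of \<open>T' w\<close>
    is the pairing of \<open>T (T' w)\<close> with w. The resulting inequality is divided by the
    norm of \<open>T' w\<close> through \<open>cancel\<close>, which covers the value 0.\<close>
  have nonexp': "L2_norm M (T' w) \<le> L2_norm M w" if w: "w \<in> L2 M" for w
  proof (rule cancel)
    have "(L2_norm M (T' w))\<^sup>2 = L2_inner M (T (T' w)) w"
      by (simp add: L2_norm_sq_inner adj T' w)
    also have "\<dots> \<le> L2_norm M (T (T' w)) * L2_norm M w"
      using L2_Cauchy_Schwarz[OF T[OF T'[OF w]] w] by linarith
    also have "\<dots> \<le> L2_norm M (T' w) * L2_norm M w"
      by (intro mult_right_mono nonexp T' w) simp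
    finally show "(L2_norm M (T' w))\<^sup>2 \<le> L2_norm M w * L2_norm M (T' w)"
      by (simp add: mult.commute)
  qed simp_all
  \<comment> \<open>The parallelogram law leaves the factor 4 - c^2 on the square, and halving the
    vector divides it by 4. The cap of c at 1 keeps the radicand positive.\<close>
  define q where "q = sqrt (1 - c\<^sup>2 / 4)"
  have c2: "0 < c\<^sup>2" "c\<^sup>2 \<le> 1"
    using c by (simp_all add: power_le_one)
  then have q: "0 \<le> q" "q < 1" "q\<^sup>2 = 1 - c\<^sup>2 / 4"
    by (auto simp: q_def)
  have gap': "L2_norm M (\<lambda>x. (1/2) *\<^sub>R (w x + T' w x)) \<le> q * L2_norm M w" if w: "w \<in> L2 M" for w
  proof (rule power2_le_imp_le)
    have "(c * L2_norm M w)\<^sup>2 \<le> (L2_norm M (\<lambda>x. w x - T' w x))\<^sup>2"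
      using c by (intro power_mono c_le w) simp
    moreover have "(L2_norm M (T' w))\<^sup>2 \<le> (L2_norm M w)\<^sup>2"
      by (intro power_mono nonexp' w) simp
    ultimately have "(L2_norm M (\<lambda>x. w x + T' w x))\<^sup>2 \<le> (4 - c\<^sup>2) * (L2_norm M w)\<^sup>2"
      using L2_norm_add_sq[OF w T'[OF w]] L2_norm_diff_sq[OF w T'[OF w]]
      unfolding power_mult_distrib left_diff_distrib by linarith
    then show "(L2_norm M (\<lambda>x. (1/2) *\<^sub>R (w x + T' w x)))\<^sup>2 \<le> (q * L2_norm M w)\<^sup>2"
      unfolding L2_norm_scaleR power_mult_distrib q(3) by (simp add: power_divide algebra_simps)
  qed (use q in simp)
  show ?thesis
  proof (rule that[OF q(1,2)], rule cancel)
    fix u :: "'a \<Rightarrow> 'b" assume u: "u \<in> L2 M"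
    let ?A = "\<lambda>x. (1/2) *\<^sub>R (u x + T u x)"
    let ?B = "\<lambda>x. (1/2) *\<^sub>R (?A x + T' ?A x)"
    have A: "?A \<in> L2 M"
      by (intro L2_scaleR L2_add u T)
    have B: "?B \<in> L2 M"
      by (intro L2_scaleR L2_add A T')
    have "(L2_norm M ?A)\<^sup>2 = L2_inner M ?A ?A"
      by (rule L2_norm_sq_inner)
    also have "\<dots> = (1/2) * (L2_inner M ?A u + L2_inner M ?A (T u))"
      unfolding L2_inner_scaleR_right by (simp add: L2_inner_add_right A u T)
    also have "\<dots> = (1/2) * (L2_inner M u ?A + L2_inner M u (T' ?A))"
      using adj[OF u A] by (simp only: L2_inner_commute[of M ?A])
    also have "\<dots> = L2_inner M u ?B"
      by (simp only: L2_inner_scaleR_right[of M u _ "\<lambda>x. ?A x + T' ?A x"]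
          L2_inner_add_right[OF u A T'[OF A]])
    also have "\<dots> \<le> L2_norm M u * L2_norm M ?B"
      using L2_Cauchy_Schwarz[OF u B] by linarith
    also have "\<dots> \<le> L2_norm M u * (q * L2_norm M ?A)"
      by (intro mult_left_mono gap' A) simp
    finally show "(L2_norm M ?A)\<^sup>2 \<le> q * L2_norm M u * L2_norm M ?A"
      by (simp add: mult_ac)
  qed (use q in simp_all)
qed

section \<open>Integral operators\<close>

lemma finite_measure_leb:
  assumes "compact D"
  shows "finite_measure (leb D)"
proof (rule finite_measureI)
  have "emeasure (leb D) D = emeasure lborel D"
    using assms by (intro emeasure_restrict_space) (auto simp: compact_imp_closed)
  then show "emeasure (leb D) (space (leb D)) \<noteq> \<infinity>"
    using emeasure_compact_finite[OF assms] by (simp add: space_restrict_space)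
qed

lemma pair_sigma_finite_leb:
  assumes "compact D"
  shows "pair_sigma_finite (leb D) (leb D)"
  using finite_measure.axioms(1)[OF finite_measure_leb[OF assms]]
  by (simp add: pair_sigma_finite_def)

lemma space_leb [simp]: "space (leb D) = D"
  by (simp add: space_restrict_space)

lemma measure_leb:
  assumes "compact D"
  shows "measure (leb D) D = measure lborel D"
  using assms by (simp add: measure_restrict_space compact_imp_closed)

lemma L2_integrable:
  assumes "finite_measure M" "f \<in> L2 M"
  shows "integrable M f"
proof -
  interpret finite_measure M
    by fact
  have int: "integrable M (\<lambda>x. 1 + (norm (f x))\<^sup>2)"
    using L2_integrable_norm_sq[OF assms(2)] by simp
  have le: "norm (f x) \<le> norm (1 + (norm (f x))\<^sup>2)" for x
    using zero_le_power2[of "1 - norm (f x)"] zero_le_power2[of "norm (f x)"] norm_ge_zero[of "f x"]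
    by (simp only: power2_diff real_norm_def power_one)
  show ?thesis
    by (rule Bochner_Integration.integrable_bound[OF int L2_borel_measurable[OF assms(2)] AE_I2[OF le]])
qed

lemma L2_const: "finite_measure M \<Longrightarrow> (\<lambda>x. c) \<in> L2 M"
  by (simp add: L2_def finite_measure.integrable_const)

lemma L2_scaleR_integrable:
  fixes \<phi> :: "'a \<Rightarrow> real" and u :: "'a \<Rightarrow> 'b::euclidean_space"
  assumes "\<phi> \<in> L2 M" "u \<in> L2 M"
  shows "integrable M (\<lambda>z. \<phi> z *\<^sub>R u z)"
proof -
  note [measurable] = L2_borel_measurable[OF assms(1)] L2_borel_measurable[OF assms(2)]
  have "integrable M (\<lambda>z. \<phi> z \<bullet> norm (u z))"
    by (rule L2_inner_integrable[OF assms(1) L2_norm_fun[OF assms(2)]])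
  then show ?thesis
    by (rule Bochner_Integration.integrable_bound) (auto simp: abs_mult)
qed

lemma norm_integral_scaleR_le:
  fixes \<phi> :: "'a \<Rightarrow> real" and u :: "'a \<Rightarrow> 'b::euclidean_space"
  assumes "\<phi> \<in> L2 M" "u \<in> L2 M"
  shows "norm (LINT z|M. \<phi> z *\<^sub>R u z) \<le> L2_norm M \<phi> * L2_norm M u"
proof -
  have "norm (LINT z|M. \<phi> z *\<^sub>R u z) \<le> (LINT z|M. norm (\<phi> z *\<^sub>R u z))"
    by (rule integral_norm_bound)
  also have "\<dots> = L2_inner M (\<lambda>z. norm (\<phi> z)) (\<lambda>z. norm (u z))"
    by (simp add: L2_inner_def)
  also have "\<dots> \<le> L2_norm M (\<lambda>z. norm (\<phi> z)) * L2_norm M (\<lambda>z. norm (u z))"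
    using L2_Cauchy_Schwarz[OF L2_norm_fun[OF assms(1)] L2_norm_fun[OF assms(2)]] by linarith
  finally show ?thesis
    by (simp only: L2_norm_norm)
qed

lemma kernel_section_measurable:
  assumes "k \<in> borel_measurable (leb2 D)" "x \<in> D"
  shows "(\<lambda>z. k (x, z)) \<in> borel_measurable (leb D)"
  using measurable_compose[OF measurable_Pair1'[of x "leb D" "leb D"] assms(1)] assms(2)
  by (simp add: comp_def)

text \<open>Fubini for the squared kernel. Off the null set excluded here, \<open>int_op\<close>
  integrates a product of two square-integrable functions; on it the integral may default to 0 and
  linearity may fail, which is why the operator identities below hold only almost
  everywhere.\<close>

lemma AE_kernel_section_L2:
  fixes k :: "'a::euclidean_space \<times> 'a \<Rightarrow> real"
  assumes D: "compact D" and k: "k \<in> L2 (leb2 D)"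
  shows "AE x in leb D. (\<lambda>z. k (x, z)) \<in> L2 (leb D)"
proof -
  interpret pair_sigma_finite "leb D" "leb D"
    by (rule pair_sigma_finite_leb[OF D])
  have "AE x in leb D. integrable (leb D) (\<lambda>z. (norm (k (x, z)))\<^sup>2)"
    using AE_integrable_fst'[OF L2_integrable_norm_sq[OF k]] by simp
  with AE_space show ?thesis
  proof eventually_elim
    case (elim x)
    then show ?case
      using kernel_section_measurable[OF L2_borel_measurable[OF k], of x] by (simp add: L2_def)
  qed
qed

lemma int_op_measurable:
  fixes k :: "'a::euclidean_space \<times> 'a \<Rightarrow> real" and u :: "'a \<Rightarrow> 'b::euclidean_space"
  assumes D: "compact D" and [measurable]: "k \<in> borel_measurable (leb2 D)" "u \<in> borel_measurable (leb D)"
  shows "int_op D k u \<in> borel_measurable (leb D)"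
proof -
  interpret pair_sigma_finite "leb D" "leb D"
    by (rule pair_sigma_finite_leb[OF D])
  have "(\<lambda>x. LINT z|leb D. k (x, z) *\<^sub>R u z) \<in> borel_measurable (leb D)"
    by (intro M1.borel_measurable_lebesgue_integral) measurable
  then show ?thesis
    by (simp add: int_op_def[abs_def])
qed

text \<open>Hilbert--Schmidt estimate: Cauchy--Schwarz in z at almost every x, then Fubini in x.
  Through it, density among square-integrable kernels becomes control of operators.\<close>

lemma
  fixes k :: "'a::euclidean_space \<times> 'a \<Rightarrow> real" and u :: "'a \<Rightarrow> 'b::euclidean_space"
  assumes D: "compact D" and k: "k \<in> L2 (leb2 D)" and u: "u \<in> L2 (leb D)"
  shows int_op_L2: "int_op D k u \<in> L2 (leb D)"
    and int_op_norm_le: "L2_norm (leb D) (int_op D k u) \<le> L2_norm (leb2 D) k * L2_norm (leb D) u"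
proof -
  interpret pair_sigma_finite "leb D" "leb D"
    by (rule pair_sigma_finite_leb[OF D])
  note [measurable] = L2_borel_measurable[OF k] L2_borel_measurable[OF u]
    int_op_measurable[OF D L2_borel_measurable[OF k] L2_borel_measurable[OF u]]
  let ?G = "\<lambda>x. (LINT z|leb D. (norm (k (x, z)))\<^sup>2) * (L2_norm (leb D) u)\<^sup>2"
  have G: "integrable (leb D) ?G"
    using integrable_fst'[OF L2_integrable_norm_sq[OF k]] by simp
  have le: "AE x in leb D. (norm (int_op D k u x))\<^sup>2 \<le> ?G x"
    using AE_kernel_section_L2[OF D k]
  proof eventually_elim
    case (elim x)
    have "norm (int_op D k u x) \<le> L2_norm (leb D) (\<lambda>z. k (x, z)) * L2_norm (leb D) u"
      unfolding int_op_def by (rule norm_integral_scaleR_le[OF elim u])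
    then have "(norm (int_op D k u x))\<^sup>2 \<le> (L2_norm (leb D) (\<lambda>z. k (x, z)) * L2_norm (leb D) u)\<^sup>2"
      by (intro power_mono) simp_all
    then show ?case
      by (simp add: power_mult_distrib L2_norm_sq)
  qed
  have "integrable (leb D) (\<lambda>x. (norm (int_op D k u x))\<^sup>2)"
    by (rule Bochner_Integration.integrable_bound[OF G]) (use le in auto)
  then show L2: "int_op D k u \<in> L2 (leb D)"
    by (simp add: L2_def)
  have "(L2_norm (leb D) (int_op D k u))\<^sup>2 \<le> (LINT x|leb D. ?G x)"
    unfolding L2_norm_sq[of "leb D" "int_op D k u"]
    by (rule integral_mono_AE[OF L2_integrable_norm_sq[OF L2] G le])
  also have "\<dots> = (LINT x|leb D. LINT z|leb D. (norm (k (x, z)))\<^sup>2) * (L2_norm (leb D) u)\<^sup>2"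
    by simp
  also have "\<dots> = (L2_norm (leb2 D) k * L2_norm (leb D) u)\<^sup>2"
    using integral_fst'[OF L2_integrable_norm_sq[OF k]] by (simp add: L2_norm_sq power_mult_distrib)
  finally show "L2_norm (leb D) (int_op D k u) \<le> L2_norm (leb2 D) k * L2_norm (leb D) u"
    by (rule power2_le_imp_le) simp
qed

lemma AE_int_op_diff:
  fixes u v :: "'a::euclidean_space \<Rightarrow> 'b::euclidean_space"
  assumes D: "compact D" and k: "k \<in> L2 (leb2 D)" and uv: "u \<in> L2 (leb D)" "v \<in> L2 (leb D)"
  shows "AE x in leb D. int_op D k (\<lambda>z. u z - v z) x = int_op D k u x - int_op D k v x"
  using AE_kernel_section_L2[OF D k]
  by eventually_elim (simp add: int_op_def scaleR_diff_right uv L2_scaleR_integrable)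

lemma AE_int_op_kernel_diff:
  fixes u :: "'a::euclidean_space \<Rightarrow> 'b::euclidean_space"
  assumes D: "compact D" and k: "k \<in> L2 (leb2 D)" "k' \<in> L2 (leb2 D)" and u: "u \<in> L2 (leb D)"
  shows "AE x in leb D. int_op D (\<lambda>p. k p - k' p) u x = int_op D k u x - int_op D k' u x"
  using AE_kernel_section_L2[OF D k(1)] AE_kernel_section_L2[OF D k(2)]
  by eventually_elim (simp add: int_op_def scaleR_diff_left u L2_scaleR_integrable)

section \<open>The adjoint of an integral operator\<close>

lemma kernel_swap_L2:
  fixes k :: "'a::euclidean_space \<times> 'a \<Rightarrow> real"
  assumes D: "compact D" and k: "k \<in> L2 (leb2 D)"
  shows "(\<lambda>p. k (snd p, fst p)) \<in> L2 (leb2 D)"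
proof -
  interpret pair_sigma_finite "leb D" "leb D"
    by (rule pair_sigma_finite_leb[OF D])
  note [measurable] = L2_borel_measurable[OF k]
  have "integrable (leb2 D) (\<lambda>(x, y). (norm (k (y, x)))\<^sup>2)"
    by (rule integrable_product_swap[OF L2_integrable_norm_sq[OF k]])
  then show ?thesis
    by (simp add: L2_def case_prod_beta')
qed

text \<open>This is the factor that multiplies the kernel when the pairing of T u with w is written
  as a double integral. Its square integrability supplies the absolute integrability that Fubini
  requires in the adjoint identity.\<close>

lemma L2_tensor_inner:
  fixes u w :: "'a::euclidean_space \<Rightarrow> 'b::euclidean_space"
  assumes D: "compact D" and u: "u \<in> L2 (leb D)" and w: "w \<in> L2 (leb D)"
  shows "(\<lambda>p. u (snd p) \<bullet> w (fst p)) \<in> L2 (leb2 D)"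
proof -
  interpret pair_sigma_finite "leb D" "leb D"
    by (rule pair_sigma_finite_leb[OF D])
  note [measurable] = L2_borel_measurable[OF u] L2_borel_measurable[OF w]
  have "integrable (leb2 D) (\<lambda>p. (norm (w (fst p)))\<^sup>2 * (norm (u (snd p)))\<^sup>2)"
    by (rule Fubini_integrable) (auto simp: L2_integrable_norm_sq u w)
  then have "(\<lambda>p. norm (w (fst p)) * norm (u (snd p))) \<in> L2 (leb2 D)"
    by (simp add: L2_def power_mult_distrib)
  then show ?thesis
    by (rule L2_bound) (auto simp: abs_mult Cauchy_Schwarz_ineq2 mult.commute)
qed

lemma int_op_adjoint:
  fixes u w :: "'a::euclidean_space \<Rightarrow> 'b::euclidean_space"
  assumes D: "compact D" and k: "k \<in> L2 (leb2 D)" and u: "u \<in> L2 (leb D)" and w: "w \<in> L2 (leb D)"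
  shows "L2_inner (leb D) (int_op D k u) w
    = L2_inner (leb D) u (int_op D (\<lambda>p. k (snd p, fst p)) w)"
proof -
  interpret pair_sigma_finite "leb D" "leb D"
    by (rule pair_sigma_finite_leb[OF D])
  note k' = kernel_swap_L2[OF D k]
  note [measurable] = L2_borel_measurable[OF k] L2_borel_measurable[OF u] L2_borel_measurable[OF w]
    L2_borel_measurable[OF int_op_L2[OF D k u]] L2_borel_measurable[OF int_op_L2[OF D k' w]]
  let ?\<phi> = "\<lambda>x z. k (x, z) * (u z \<bullet> w x)"
  have int: "integrable (leb2 D) (\<lambda>(x, z). ?\<phi> x z)"
    using L2_inner_integrable[OF k L2_tensor_inner[OF D u w]] by (simp add: case_prod_beta')
  have "L2_inner (leb D) (int_op D k u) w = (LINT x|leb D. LINT z|leb D. ?\<phi> x z)"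
    unfolding L2_inner_def
  proof (rule integral_cong_AE)
    show "AE x in leb D. int_op D k u x \<bullet> w x = (LINT z|leb D. ?\<phi> x z)"
      using AE_kernel_section_L2[OF D k]
    proof eventually_elim
      case (elim x)
      show ?case
        using integral_inner_left[OF L2_scaleR_integrable[OF elim u], of "w x"]
        by (simp add: int_op_def)
    qed
  qed measurable
  also have "\<dots> = (LINT z|leb D. LINT x|leb D. ?\<phi> x z)"
    by (rule Fubini_integral[OF int, symmetric])
  also have "\<dots> = L2_inner (leb D) u (int_op D (\<lambda>p. k (snd p, fst p)) w)"
    unfolding L2_inner_def
  proof (rule integral_cong_AE)
    show "AE z in leb D. (LINT x|leb D. ?\<phi> x z) = u z \<bullet> int_op D (\<lambda>p. k (snd p, fst p)) w z"
      using AE_kernel_section_L2[OF D k']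
    proof eventually_elim
      case (elim z)
      show ?case
        using integral_inner_right[OF L2_scaleR_integrable[OF elim w], of "u z"]
        by (simp add: int_op_def)
    qed
  qed measurable
  finally show ?thesis .
qed

section \<open>Perturbation of the kernel\<close>

definition averaged_op ::
    "'a::euclidean_space set \<Rightarrow> ('a \<times> 'a \<Rightarrow> real) \<Rightarrow> ('a \<Rightarrow> 'b::euclidean_space) \<Rightarrow> 'a \<Rightarrow> 'b" where
  "averaged_op D k u x = (1/2) *\<^sub>R (u x + int_op D k u x)"

text \<open>Indexed in step with \<open>fnn_hidden\<close> at \<kappa> = 1/2: index 0 is the first
  hidden layer, and the exact integral stands in place of the weighted sum over the nodes.\<close>

primrec km_iterate ::
    "'a::euclidean_space set \<Rightarrow> ('a \<times> 'a \<Rightarrow> real) \<Rightarrow> ('a \<Rightarrow> 'b::euclidean_space) \<Rightarrow> nat \<Rightarrow> 'a \<Rightarrow> 'b" where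
  "km_iterate D k g 0 = (\<lambda>x. (1/2) *\<^sub>R g x)"
| "km_iterate D k g (Suc n) = (\<lambda>x. (1/2) *\<^sub>R g x + averaged_op D k (km_iterate D k g n) x)"

lemma averaged_op_L2:
  assumes "compact D" "k \<in> L2 (leb2 D)" "u \<in> L2 (leb D)"
  shows "averaged_op D k u \<in> L2 (leb D)"
  unfolding averaged_op_def[abs_def] by (intro L2_scaleR L2_add int_op_L2 assms)

lemma km_iterate_L2:
  assumes "compact D" "k \<in> L2 (leb2 D)" "g \<in> L2 (leb D)"
  shows "km_iterate D k g n \<in> L2 (leb D)"
  by (induction n) (auto intro!: L2_add averaged_op_L2 L2_scaleR assms)

lemma averaged_op_diff_norm:
  fixes u v :: "'a::euclidean_space \<Rightarrow> 'b::euclidean_space"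
  assumes D: "compact D" and k: "k \<in> L2 (leb2 D)" and uv: "u \<in> L2 (leb D)" "v \<in> L2 (leb D)"
  shows "L2_norm (leb D) (\<lambda>x. averaged_op D k u x - averaged_op D k v x)
    = L2_norm (leb D) (averaged_op D k (\<lambda>x. u x - v x))"
proof (rule L2_norm_cong_AE)
  show "AE x in leb D. averaged_op D k u x - averaged_op D k v x = averaged_op D k (\<lambda>x. u x - v x) x"
    using AE_int_op_diff[OF D k uv]
    by eventually_elim (simp add: averaged_op_def scaleR_diff_right scaleR_add_right)
qed (intro L2_borel_measurable L2_diff averaged_op_L2 D k uv)+

lemma averaged_op_gap:
  fixes D :: "'a::euclidean_space set" and K :: "'a \<times> 'a \<Rightarrow> real"
    and S :: "('a \<Rightarrow> 'b::euclidean_space) \<Rightarrow> ('a \<Rightarrow> 'b)"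
  assumes D: "compact D" and K: "K \<in> L2 (leb2 D)"
    and nonexp: "nonexpansive_L2 (leb D) (int_op D K :: ('a \<Rightarrow> 'b) \<Rightarrow> ('a \<Rightarrow> 'b))"
    and S: "solution_operator D K S"
  obtains q where "0 \<le> q" "q < 1"
    "\<And>u :: 'a \<Rightarrow> 'b. u \<in> L2 (leb D) \<Longrightarrow> L2_norm (leb D) (averaged_op D K u) \<le> q * L2_norm (leb D) u"
proof -
  let ?K' = "\<lambda>p. K (snd p, fst p)"
  have ne: "L2_norm (leb D) (int_op D K u) \<le> L2_norm (leb D) u" if "u \<in> L2 (leb D)" for u :: "'a \<Rightarrow> 'b"
    using nonexp[unfolded nonexpansive_L2_def lipschitz_L2_def, rule_format, OF that L2_zero]
    by (simp add: int_op_def[abs_def])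
  have solv: "\<exists>f\<in>L2 (leb D). AE x in leb D. f x = g x + int_op D K f x"
    if "g \<in> L2 (leb D)" for g :: "'a \<Rightarrow> 'b"
    using S that unfolding solution_operator_def by blast
  show ?thesis
    by (rule L2_averaged_operator_gap[OF int_op_L2[OF D K] int_op_L2[OF D kernel_swap_L2[OF D K]]
          int_op_adjoint[OF D K] ne solv that[unfolded averaged_op_def[abs_def]]])
qed

text \<open>The two averaged operators differ by half of the integral operator with kernel k - K,
  whence \<delta> / 2 by the Hilbert--Schmidt estimate.\<close>

lemma averaged_op_perturb:
  fixes u :: "'a::euclidean_space \<Rightarrow> 'b::euclidean_space"
  assumes D: "compact D" and K: "K \<in> L2 (leb2 D)" and k: "k \<in> L2 (leb2 D)"
    and close: "L2_norm (leb2 D) (\<lambda>p. K p - k p) \<le> \<delta>"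
    and gap: "L2_norm (leb D) (averaged_op D K u) \<le> q * L2_norm (leb D) u"
    and u: "u \<in> L2 (leb D)"
  shows "L2_norm (leb D) (averaged_op D k u) \<le> (q + \<delta> / 2) * L2_norm (leb D) u"
proof -
  note KK = L2_diff[OF k K]
  let ?d = "\<lambda>x. (1/2) *\<^sub>R int_op D (\<lambda>p. k p - K p) u x"
  have d: "?d \<in> L2 (leb D)"
    by (intro L2_scaleR int_op_L2 D KK u)
  have "L2_norm (leb D) (averaged_op D k u) = L2_norm (leb D) (\<lambda>x. averaged_op D K u x + ?d x)"
  proof (rule L2_norm_cong_AE)
    show "AE x in leb D. averaged_op D k u x = averaged_op D K u x + ?d x"
      using AE_int_op_kernel_diff[OF D k K u]
      by eventually_elim (simp add: averaged_op_def scaleR_diff_right scaleR_add_right)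
  qed (intro L2_borel_measurable L2_add averaged_op_L2 d D k K u)+
  also have "\<dots> \<le> L2_norm (leb D) (averaged_op D K u) + L2_norm (leb D) ?d"
    by (intro L2_norm_triangle averaged_op_L2 d D K u)
  also have "L2_norm (leb D) ?d = 1/2 * L2_norm (leb D) (int_op D (\<lambda>p. k p - K p) u)"
    by (simp add: L2_norm_scaleR)
  also have "L2_norm (leb D) (int_op D (\<lambda>p. k p - K p) u) \<le> \<delta> * L2_norm (leb D) u"
    by (rule order_trans[OF int_op_norm_le[OF D KK u]])
      (use close in \<open>simp add: L2_norm_minus_commute[of _ k] mult_right_mono\<close>)
  finally show ?thesis
    using gap by (simp add: algebra_simps)
qed

text \<open>Adding f to both sides and halving shows that averaging keeps the fixed points. Being an
  equivalence at a single point, it can be used under an almost-everywhere quantifier.\<close>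

lemma solution_iff_averaged:
  "f x = g x + int_op D k f x \<longleftrightarrow> f x = (1/2) *\<^sub>R g x + averaged_op D k f x"
  unfolding euclidean_eq_iff[of "f x"]
  by (intro ball_cong) (auto simp: averaged_op_def inner_simps field_simps)

lemma le_0_if_le_geometric:
  fixes a B q :: real
  assumes "0 \<le> q" "q < 1" "\<And>n. a \<le> B * q ^ n"
  shows "a \<le> 0"
proof (rule LIMSEQ_le_const)
  show "(\<lambda>n. B * q ^ n) \<longlonglongrightarrow> 0"
    using LIMSEQ_realpow_zero[OF assms(1,2)] by (rule tendsto_mult_right_zero)
qed (use assms(3) in blast)

text \<open>Banach's fixed-point argument in quantitative form. The iteration starts at g / 2, so
  its first increment is the averaged operator applied to g / 2, of norm at most q / 2 times that of
  g. The error bound is proportional to the norm of g and hence uniform over balls.\<close>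

lemma km_iterate_converges:
  fixes g :: "'a::euclidean_space \<Rightarrow> 'b::euclidean_space"
  assumes D: "compact D" and k: "k \<in> L2 (leb2 D)" and q: "0 < q" "q < 1"
    and gap: "\<And>u :: 'a \<Rightarrow> 'b. u \<in> L2 (leb D) \<Longrightarrow> L2_norm (leb D) (averaged_op D k u) \<le> q * L2_norm (leb D) u"
    and g: "g \<in> L2 (leb D)"
  obtains f where "f \<in> L2 (leb D)" "AE x in leb D. f x = g x + int_op D k f x"
    "\<And>n. L2_norm (leb D) (\<lambda>x. f x - km_iterate D k g n x) \<le> L2_norm (leb D) g * q ^ n / (1 - q)"
proof -
  let ?F = "km_iterate D k g" and ?C = "L2_norm (leb D) g"
  have F: "?F n \<in> L2 (leb D)" for n
    by (rule km_iterate_L2[OF D k g])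
  have step: "L2_norm (leb D) (\<lambda>x. ?F (Suc n) x - ?F n x) \<le> ?C * q ^ n" for n
  proof (induction n)
    case 0
    have "L2_norm (leb D) (\<lambda>x. ?F (Suc 0) x - ?F 0 x) = L2_norm (leb D) (averaged_op D k (?F 0))"
      by simp
    also have "\<dots> \<le> q * L2_norm (leb D) (?F 0)"
      by (rule gap[OF F])
    also have "\<dots> = q / 2 * ?C"
      by (simp add: L2_norm_scaleR)
    also have "\<dots> \<le> 1 * ?C"
      using q by (intro mult_right_mono) auto
    finally show ?case
      by simp
  next
    case (Suc n)
    have "L2_norm (leb D) (\<lambda>x. ?F (Suc (Suc n)) x - ?F (Suc n) x)
        = L2_norm (leb D) (\<lambda>x. averaged_op D k (?F (Suc n)) x - averaged_op D k (?F n) x)"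
      by (simp only: km_iterate.simps(2)[of _ _ _ "Suc n"] km_iterate.simps(2)[of _ _ _ n]
          add_diff_cancel_left)
    also have "\<dots> = L2_norm (leb D) (averaged_op D k (\<lambda>x. ?F (Suc n) x - ?F n x))"
      by (rule averaged_op_diff_norm[OF D k F F])
    also have "\<dots> \<le> q * L2_norm (leb D) (\<lambda>x. ?F (Suc n) x - ?F n x)"
      by (rule gap[OF L2_diff[OF F F]])
    also have "\<dots> \<le> q * (?C * q ^ n)"
      using q by (intro mult_left_mono Suc.IH) simp
    finally show ?case
      by (simp add: mult_ac)
  qed
  obtain f where f: "f \<in> L2 (leb D)"
    and f_le: "\<And>n. L2_norm (leb D) (\<lambda>x. f x - ?F n x) \<le> ?C * q ^ n / (1 - q)"
    by (rule L2_complete_geometric[OF F step q]) blast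
  \<comment> \<open>The limit is recognised as a fixed point by comparing it with its image via the
    iterate of index n + 1: their distance is at most a multiple of q^n for every n.\<close>
  let ?\<Phi> = "\<lambda>x. (1/2) *\<^sub>R g x + averaged_op D k f x"
  have \<Phi>: "?\<Phi> \<in> L2 (leb D)"
    by (intro L2_add L2_scaleR g averaged_op_L2 D k f)
  have "L2_norm (leb D) (\<lambda>x. f x - ?\<Phi> x) \<le> (2 * ?C / (1 - q)) * q ^ n" for n
  proof -
    have "L2_norm (leb D) (\<lambda>x. f x - ?\<Phi> x)
        \<le> L2_norm (leb D) (\<lambda>x. f x - ?F (Suc n) x) + L2_norm (leb D) (\<lambda>x. ?F (Suc n) x - ?\<Phi> x)"
      by (rule L2_norm_triangle_diff[OF f F \<Phi>])
    also have "L2_norm (leb D) (\<lambda>x. ?F (Suc n) x - ?\<Phi> x)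
        = L2_norm (leb D) (averaged_op D k (\<lambda>x. ?F n x - f x))"
      using averaged_op_diff_norm[OF D k F f, of n] by simp
    also have "\<dots> \<le> q * L2_norm (leb D) (\<lambda>x. ?F n x - f x)"
      by (rule gap[OF L2_diff[OF F f]])
    also have "\<dots> \<le> q * (?C * q ^ n / (1 - q))"
      using q f_le[of n] by (intro mult_left_mono) (simp_all add: L2_norm_minus_commute[of _ _ f])
    also have "\<dots> \<le> 1 * (?C * q ^ n / (1 - q))"
      using q by (intro mult_right_mono) auto
    also have "L2_norm (leb D) (\<lambda>x. f x - ?F (Suc n) x) \<le> ?C * q ^ Suc n / (1 - q)"
      by (rule f_le)
    also have "\<dots> \<le> ?C * q ^ n / (1 - q)"
      using q by (intro divide_right_mono mult_left_mono) (auto simp: mult_le_cancel_right1)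
    finally show ?thesis
      by (simp add: field_simps)
  qed
  then have "L2_norm (leb D) (\<lambda>x. f x - ?\<Phi> x) \<le> 0"
    by (rule le_0_if_le_geometric[OF less_imp_le[OF q(1)] q(2)])
  then have "L2_norm (leb D) (\<lambda>x. f x - ?\<Phi> x) = 0"
    by (simp add: antisym)
  then have "AE x in leb D. f x - ?\<Phi> x = 0"
    by (rule L2_norm_eq_0_AE[OF L2_diff[OF f \<Phi>]])
  then have "AE x in leb D. f x = g x + int_op D k f x"
    by eventually_elim (subst solution_iff_averaged, simp)
  with f f_le show ?thesis
    by (intro that)
qed

text \<open>Resolvent argument: up to null sets h = f - f' equals the averaged operator of k at h
  plus half the integral operator of K - k at f. Absorbing the first term costs one factor 1 / (1 -
  q); bounding f by g through the gap of K costs the other.\<close>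

lemma solution_stability:
  fixes g f f' :: "'a::euclidean_space \<Rightarrow> 'b::euclidean_space"
  assumes D: "compact D" and K: "K \<in> L2 (leb2 D)" and k: "k \<in> L2 (leb2 D)"
    and close: "L2_norm (leb2 D) (\<lambda>p. K p - k p) \<le> \<delta>" and q: "q < 1"
    and gapK: "L2_norm (leb D) (averaged_op D K f) \<le> q * L2_norm (leb D) f"
    and gapk: "\<And>u :: 'a \<Rightarrow> 'b. u \<in> L2 (leb D) \<Longrightarrow> L2_norm (leb D) (averaged_op D k u) \<le> q * L2_norm (leb D) u"
    and g: "g \<in> L2 (leb D)" and f: "f \<in> L2 (leb D)" and f': "f' \<in> L2 (leb D)"
    and eq: "AE x in leb D. f x = g x + int_op D K f x"
    and eq': "AE x in leb D. f' x = g x + int_op D k f' x"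
  shows "L2_norm (leb D) (\<lambda>x. f x - f' x) \<le> \<delta> * L2_norm (leb D) g / (1 - q)\<^sup>2"
proof -
  have \<delta>: "0 \<le> \<delta>"
    using close order_trans[OF L2_norm_nonneg] by blast
  have "L2_norm (leb D) f = L2_norm (leb D) (\<lambda>x. (1/2) *\<^sub>R g x + averaged_op D K f x)"
  proof (rule L2_norm_cong_AE)
    show "AE x in leb D. f x = (1/2) *\<^sub>R g x + averaged_op D K f x"
      using eq by eventually_elim (simp only: solution_iff_averaged[of f _ g])
  qed (intro L2_borel_measurable f L2_add L2_scaleR g averaged_op_L2 D K)+
  also have "\<dots> \<le> L2_norm (leb D) (\<lambda>x. (1/2) *\<^sub>R g x) + L2_norm (leb D) (averaged_op D K f)"
    by (intro L2_norm_triangle L2_scaleR g averaged_op_L2 D K f)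
  also have "\<dots> \<le> L2_norm (leb D) g + q * L2_norm (leb D) f"
    using gapK by (simp add: L2_norm_scaleR add_mono)
  finally have nf: "L2_norm (leb D) f \<le> L2_norm (leb D) g / (1 - q)"
    using q by (simp add: field_simps)
  note KK = L2_diff[OF K k] and h = L2_diff[OF f f']
  let ?h = "\<lambda>x. f x - f' x" and ?d = "\<lambda>x. (1/2) *\<^sub>R int_op D (\<lambda>p. K p - k p) f x"
  have d: "?d \<in> L2 (leb D)"
    by (intro L2_scaleR int_op_L2 D KK f)
  have "L2_norm (leb D) ?h = L2_norm (leb D) (\<lambda>x. averaged_op D k ?h x + ?d x)"
  proof (rule L2_norm_cong_AE)
    show "AE x in leb D. ?h x = averaged_op D k ?h x + ?d x"
      using eq eq' AE_int_op_kernel_diff[OF D K k f] AE_int_op_diff[OF D k f f']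
    proof eventually_elim
      case (elim x)
      have "?h x = averaged_op D K f x - averaged_op D k f' x"
        using elim(1,2) solution_iff_averaged[of f x g D K] solution_iff_averaged[of f' x g D k]
        by (metis add_diff_cancel_left)
      also have "\<dots> = averaged_op D k ?h x + ?d x"
        using elim(3,4) by (simp add: averaged_op_def scaleR_diff_right scaleR_add_right)
      finally show ?case .
    qed
  qed (intro L2_borel_measurable L2_add averaged_op_L2 d D k h)+
  also have "\<dots> \<le> L2_norm (leb D) (averaged_op D k ?h) + L2_norm (leb D) ?d"
    by (intro L2_norm_triangle averaged_op_L2 d D k h)
  also have "L2_norm (leb D) ?d \<le> L2_norm (leb D) (int_op D (\<lambda>p. K p - k p) f)"
    by (simp add: L2_norm_scaleR)
  also have "\<dots> \<le> \<delta> * L2_norm (leb D) f"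
    by (rule order_trans[OF int_op_norm_le[OF D KK f]]) (use close in \<open>simp add: mult_right_mono\<close>)
  also have "\<dots> \<le> \<delta> * (L2_norm (leb D) g / (1 - q))"
    by (rule mult_left_mono[OF nf \<delta>])
  also have "L2_norm (leb D) (averaged_op D k ?h) \<le> q * L2_norm (leb D) ?h"
    by (rule gapk[OF h])
  finally have "L2_norm (leb D) ?h * (1 - q) \<le> \<delta> * (L2_norm (leb D) g / (1 - q))"
    unfolding right_diff_distrib by (simp add: mult.commute)
  then have "L2_norm (leb D) ?h \<le> \<delta> * (L2_norm (leb D) g / (1 - q)) / (1 - q)"
    using q by (subst pos_le_divide_eq) simp_all
  then show ?thesis
    by (simp add: power2_eq_square)
qed

text \<open>Stability with the same kernel in both roles and \<delta> = 0.\<close>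

lemma solution_unique:
  fixes g f f' :: "'a::euclidean_space \<Rightarrow> 'b::euclidean_space"
  assumes D: "compact D" and k: "k \<in> L2 (leb2 D)" and q: "q < 1"
    and gap: "\<And>u :: 'a \<Rightarrow> 'b. u \<in> L2 (leb D) \<Longrightarrow> L2_norm (leb D) (averaged_op D k u) \<le> q * L2_norm (leb D) u"
    and g: "g \<in> L2 (leb D)" and f: "f \<in> L2 (leb D)" and f': "f' \<in> L2 (leb D)"
    and eq: "AE x in leb D. f x = g x + int_op D k f x"
    and eq': "AE x in leb D. f' x = g x + int_op D k f' x"
  shows "AE x in leb D. f x = f' x"
proof -
  have "L2_norm (leb D) (\<lambda>x. f x - f' x) \<le> 0 * L2_norm (leb D) g / (1 - q)\<^sup>2"
    by (rule solution_stability[OF D k k _ q gap[OF f] gap g f f' eq eq']) simp_all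
  then have "L2_norm (leb D) (\<lambda>x. f x - f' x) = 0"
    by (simp add: antisym)
  from L2_norm_eq_0_AE[OF L2_diff[OF f f'] this] show ?thesis
    by simp
qed

lemma solution_operator_exists:
  fixes D :: "'a::euclidean_space set"
  assumes D: "compact D" and k: "k \<in> L2 (leb2 D)" and q: "0 < q" "q < 1"
    and gap: "\<And>u :: 'a \<Rightarrow> 'b. u \<in> L2 (leb D) \<Longrightarrow>
      L2_norm (leb D) (averaged_op D k u) \<le> q * L2_norm (leb D) u"
  obtains S :: "('a \<Rightarrow> 'b::euclidean_space) \<Rightarrow> ('a \<Rightarrow> 'b)" where "solution_operator D k S"
    "\<And>g n. g \<in> L2 (leb D) \<Longrightarrow>
      L2_norm (leb D) (\<lambda>x. S g x - km_iterate D k g n x) \<le> L2_norm (leb D) g * q ^ n / (1 - q)"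
proof -
  define P :: "('a \<Rightarrow> 'b) \<Rightarrow> ('a \<Rightarrow> 'b) \<Rightarrow> bool" where
    "P g f \<longleftrightarrow> f \<in> L2 (leb D) \<and> (AE x in leb D. f x = g x + int_op D k f x) \<and>
      (\<forall>n. L2_norm (leb D) (\<lambda>x. f x - km_iterate D k g n x) \<le> L2_norm (leb D) g * q ^ n / (1 - q))" for g f
  have "\<exists>f. P g f" if g: "g \<in> L2 (leb D)" for g
    by (rule km_iterate_converges[OF D k q gap g]) (auto simp: P_def)
  then obtain S where S: "\<And>g. g \<in> L2 (leb D) \<Longrightarrow> P g (S g)"
    by metis
  show ?thesis
  proof (rule that)
    show "solution_operator D k S"
      unfolding solution_operator_def
    proof (intro ballI conjI impI)
      fix g f :: "'a \<Rightarrow> 'b" assume g: "g \<in> L2 (leb D)"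
      show Sg: "S g \<in> L2 (leb D)" "AE x in leb D. S g x = g x + int_op D k (S g) x"
        using S[OF g] by (simp_all add: P_def)
      assume f: "f \<in> L2 (leb D)" "AE x in leb D. f x = g x + int_op D k f x"
      show "AE x in leb D. f x = S g x"
        by (rule solution_unique[OF D k q(2) gap g f(1) Sg(1) f(2) Sg(2)])
    qed
  qed (use S in \<open>simp add: P_def\<close>)
qed

section \<open>Transfer of operator bounds to a nearby kernel\<close>

lemma op_norm_int_op_diff_le:
  fixes D :: "'a::euclidean_space set"
  assumes D: "compact D" and K: "K \<in> L2 (leb2 D)" and k: "k \<in> L2 (leb2 D)"
    and close: "L2_norm (leb2 D) (\<lambda>p. K p - k p) \<le> \<delta>"
  shows "op_norm (leb D) (\<lambda>(u :: 'a \<Rightarrow> 'b::euclidean_space) x. int_op D K u x - int_op D k u x) \<le> ennreal \<delta>"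
  unfolding op_norm_def
proof (rule SUP_least)
  fix u :: "'a \<Rightarrow> 'b" assume "u \<in> {u \<in> L2 (leb D). L2_norm (leb D) u \<le> 1}"
  then have u: "u \<in> L2 (leb D)" and u1: "L2_norm (leb D) u \<le> 1"
    by auto
  have "L2_norm (leb D) (\<lambda>x. int_op D K u x - int_op D k u x)
      = L2_norm (leb D) (int_op D (\<lambda>p. K p - k p) u)"
  proof (rule L2_norm_cong_AE)
    show "AE x in leb D. int_op D K u x - int_op D k u x = int_op D (\<lambda>p. K p - k p) u x"
      using AE_int_op_kernel_diff[OF D K k u] by eventually_elim simp
  qed (intro L2_borel_measurable L2_diff int_op_L2 D K k u)+
  also have "\<dots> \<le> L2_norm (leb2 D) (\<lambda>p. K p - k p) * L2_norm (leb D) u"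
    by (rule int_op_norm_le[OF D L2_diff[OF K k] u])
  also have "\<dots> \<le> L2_norm (leb2 D) (\<lambda>p. K p - k p) * 1"
    using u1 by (intro mult_left_mono) simp_all
  also have "\<dots> \<le> \<delta>"
    using close by simp
  finally show "ennreal (L2_norm (leb D) (\<lambda>x. int_op D K u x - int_op D k u x)) \<le> ennreal \<delta>"
    by (rule ennreal_leI)
qed

lemma lipschitz_int_op_perturb:
  fixes D :: "'a::euclidean_space set"
  assumes D: "compact D" and K: "K \<in> L2 (leb2 D)" and k: "k \<in> L2 (leb2 D)"
    and close: "L2_norm (leb2 D) (\<lambda>p. K p - k p) \<le> \<delta>"
    and lip: "lipschitz_L2 (leb D) \<rho> (int_op D K :: ('a \<Rightarrow> 'b::euclidean_space) \<Rightarrow> ('a \<Rightarrow> 'b))"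
  shows "lipschitz_L2 (leb D) (\<rho> + \<delta>) (int_op D k :: ('a \<Rightarrow> 'b) \<Rightarrow> ('a \<Rightarrow> 'b))"
  unfolding lipschitz_L2_def
proof (intro ballI)
  fix u v :: "'a \<Rightarrow> 'b" assume uv: "u \<in> L2 (leb D)" "v \<in> L2 (leb D)"
  let ?h = "\<lambda>x. u x - v x"
  note h = L2_diff[OF uv] and KK = L2_diff[OF k K]
  have "L2_norm (leb D) (\<lambda>x. int_op D k u x - int_op D k v x)
      = L2_norm (leb D) (\<lambda>x. (int_op D K u x - int_op D K v x) + int_op D (\<lambda>p. k p - K p) ?h x)"
  proof (rule L2_norm_cong_AE)
    show "AE x in leb D. int_op D k u x - int_op D k v x
        = (int_op D K u x - int_op D K v x) + int_op D (\<lambda>p. k p - K p) ?h x"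
      using AE_int_op_diff[OF D k uv] AE_int_op_diff[OF D K uv] AE_int_op_kernel_diff[OF D k K h]
      by eventually_elim simp
  qed (intro L2_borel_measurable L2_add L2_diff int_op_L2 D K k KK h uv)+
  also have "\<dots> \<le> L2_norm (leb D) (\<lambda>x. int_op D K u x - int_op D K v x)
      + L2_norm (leb D) (int_op D (\<lambda>p. k p - K p) ?h)"
    by (intro L2_norm_triangle L2_diff int_op_L2 D K KK h uv)
  also have "L2_norm (leb D) (\<lambda>x. int_op D K u x - int_op D K v x) \<le> \<rho> * L2_norm (leb D) ?h"
    using lip uv by (simp add: lipschitz_L2_def)
  also have "L2_norm (leb D) (int_op D (\<lambda>p. k p - K p) ?h) \<le> \<delta> * L2_norm (leb D) ?h"
    by (rule order_trans[OF int_op_norm_le[OF D KK h]])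
      (use close in \<open>simp add: L2_norm_minus_commute[of _ k] mult_right_mono\<close>)
  finally show "L2_norm (leb D) (\<lambda>x. int_op D k u x - int_op D k v x) \<le> (\<rho> + \<delta>) * L2_norm (leb D) ?h"
    by (simp add: algebra_simps)
qed

section \<open>Quadrature nodes\<close>

text \<open>A function exceeding b almost everywhere would have a mean above b, since the measure is
  positive. The side condition \<open>P\<close> lets the point found avoid a null set, in its use
  the nodes already chosen.\<close>

lemma exists_le_average:
  assumes "finite_measure M" and pos: "measure M (space M) > 0" and int: "integrable M \<psi>"
    and le: "(LINT z|M. \<psi> z) \<le> b * measure M (space M)" and P: "AE z in M. P z"
  shows "\<exists>z\<in>space M. P z \<and> \<psi> z \<le> (b :: real)"
proof (rule ccontr)
  interpret finite_measure M
    by fact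
  assume no: "\<not> ?thesis"
  have gt: "AE z in M. b < \<psi> z"
    using P AE_space by eventually_elim (use no in force)
  have int': "integrable M (\<lambda>z. \<psi> z - b)"
    using int by simp
  have "(LINT z|M. \<psi> z - b) \<le> 0"
    using le int by (simp add: mult.commute)
  moreover have nonneg: "AE z in M. 0 \<le> \<psi> z - b"
    using gt by eventually_elim simp
  ultimately have "(LINT z|M. \<psi> z - b) = 0"
    using integral_nonneg_AE[OF nonneg] by linarith
  then have "AE z in M. \<psi> z - b = 0"
    using integral_nonneg_eq_0_iff_AE[OF int' nonneg] by simp
  with gt have "AE z in M. False"
    by eventually_elim simp
  then have "ae_filter M = bot"
    by (simp add: eventually_False)
  then have "emeasure M (space M) = 0"
    by (simp add: ae_filter_eq_bot_iff)
  with pos show False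
    by (simp add: measure_def)
qed

lemma integrable_leb2_fst:
  fixes f :: "'a::euclidean_space \<Rightarrow> real"
  assumes D: "compact D" and f: "integrable (leb D) f"
  shows "integrable (leb2 D) (\<lambda>p. f (fst p))"
proof -
  interpret pair_sigma_finite "leb D" "leb D"
    by (rule pair_sigma_finite_leb[OF D])
  interpret finite_measure "leb D"
    by (rule finite_measure_leb[OF D])
  note [measurable] = borel_measurable_integrable[OF f]
  show ?thesis
    by (rule Fubini_integrable) (auto simp: f)
qed

lemma integrable_leb2_snd:
  fixes f :: "'a::euclidean_space \<Rightarrow> real"
  assumes D: "compact D" and f: "integrable (leb D) f"
  shows "integrable (leb2 D) (\<lambda>p. f (snd p))"
proof -
  interpret pair_sigma_finite "leb D" "leb D"
    by (rule pair_sigma_finite_leb[OF D])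
  show ?thesis
    using integrable_product_swap[OF integrable_leb2_fst[OF D f]] by (simp add: case_prod_beta')
qed

definition quad_error :: "('a \<Rightarrow> 'a \<Rightarrow> 'b::euclidean_space) \<Rightarrow> 'a set \<Rightarrow> 'a \<Rightarrow> 'b" where
  "quad_error h Z x = (\<Sum>z\<in>Z. h z x)"

text \<open>The error matters at two places: at the nodes, where the hidden layers are evaluated,
  and in the mean over \<open>D\<close>, where the output is measured. \<mu> is the exchange rate
  between them.\<close>

definition quad_energy ::
    "'a::euclidean_space set \<Rightarrow> ('a \<Rightarrow> 'a \<Rightarrow> 'b::euclidean_space) \<Rightarrow> real \<Rightarrow> 'a set \<Rightarrow> real" where
  "quad_energy D h \<mu> Z =
     (\<Sum>y\<in>Z. (norm (quad_error h Z y))\<^sup>2) + \<mu> * (L2_norm (leb D) (quad_error h Z))\<^sup>2"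

text \<open>\<open>h z x\<close> is the contribution of the node \<open>z\<close> to the quadrature error at \<open>x\<close>.\<close>

definition error_field ::
    "'a::euclidean_space set \<Rightarrow> ('a \<Rightarrow> 'a \<Rightarrow> 'b::euclidean_space) \<Rightarrow> ('a \<Rightarrow> real) \<Rightarrow> bool" where
  "error_field D h H \<longleftrightarrow>
     (\<lambda>p. h (fst p) (snd p)) \<in> borel_measurable (leb2 D) \<and> H \<in> L2 (leb D) \<and>
     (\<forall>z\<in>D. \<forall>x\<in>D. norm (h z x) \<le> H z) \<and> (\<forall>x\<in>D. (LINT z|leb D. h z x) = 0)"

lemma error_field_section:
  assumes h: "error_field D h H" and x: "x \<in> D"
  shows "(\<lambda>z. h z x) \<in> L2 (leb D)" "L2_norm (leb D) (\<lambda>z. h z x) \<le> L2_norm (leb D) H"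
proof -
  have meas: "(\<lambda>z. h z x) \<in> borel_measurable (leb D)"
    using measurable_compose[OF measurable_Pair2'[of x "leb D" "leb D"], of "\<lambda>p. h (fst p) (snd p)"] h x
    by (simp add: error_field_def)
  have le: "AE z in leb D. norm (h z x) \<le> norm (H z)"
    using AE_space by eventually_elim (use h x in \<open>force simp: error_field_def\<close>)
  show "(\<lambda>z. h z x) \<in> L2 (leb D)" "L2_norm (leb D) (\<lambda>z. h z x) \<le> L2_norm (leb D) H"
    using h L2_bound[OF _ meas le] L2_norm_mono_AE[OF _ meas le] by (simp_all add: error_field_def)
qed

lemma quad_error_L2:
  assumes D: "compact D" and h: "error_field D h H" and Z: "finite Z" "Z \<subseteq> D"
  shows "quad_error h Z \<in> L2 (leb D)"
  unfolding quad_error_def[abs_def]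
proof (rule L2_sum)
  fix z assume z: "z \<in> Z"
  then have "z \<in> D"
    using Z by auto
  have meas: "(\<lambda>x. h z x) \<in> borel_measurable (leb D)"
    using measurable_compose[OF measurable_Pair1'[of z "leb D" "leb D"], of "\<lambda>p. h (fst p) (snd p)"]
      h \<open>z \<in> D\<close>
    by (simp add: error_field_def)
  have "AE x in leb D. norm (h z x) \<le> norm (H z)"
    using AE_space by eventually_elim (use h \<open>z \<in> D\<close> in \<open>force simp: error_field_def\<close>)
  from L2_bound[OF L2_const[OF finite_measure_leb[OF D]] meas this]
  show "(\<lambda>x. h z x) \<in> L2 (leb D)" .
qed

text \<open>A variance computation: h has mean zero in the node, so the cross term with the constant
  a vanishes. In its use, a is the error already accumulated at x.\<close>

lemma error_field_average:
  fixes h :: "'a::euclidean_space \<Rightarrow> 'a \<Rightarrow> 'b::euclidean_space"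
  assumes D: "compact D" and h: "error_field D h H" and x: "x \<in> D"
  shows "integrable (leb D) (\<lambda>z. (norm (a + h z x))\<^sup>2)"
    and "(LINT z|leb D. (norm (a + h z x))\<^sup>2) \<le> measure lborel D * (norm a)\<^sup>2 + (L2_norm (leb D) H)\<^sup>2"
proof -
  have a: "(\<lambda>z. a) \<in> L2 (leb D)"
    by (rule L2_const[OF finite_measure_leb[OF D]])
  note hx = error_field_section[OF h x]
  show "integrable (leb D) (\<lambda>z. (norm (a + h z x))\<^sup>2)"
    by (rule L2_integrable_norm_sq[OF L2_add[OF a hx(1)]])
  have "L2_inner (leb D) (\<lambda>z. a) (\<lambda>z. h z x) = a \<bullet> (LINT z|leb D. h z x)"
    unfolding L2_inner_def
    by (rule integral_inner_right) (rule L2_integrable[OF finite_measure_leb[OF D] hx(1)])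
  also have "\<dots> = 0"
    using h x by (simp add: error_field_def)
  finally have "(LINT z|leb D. (norm (a + h z x))\<^sup>2)
      = (L2_norm (leb D) (\<lambda>z. a))\<^sup>2 + (L2_norm (leb D) (\<lambda>z. h z x))\<^sup>2"
    using L2_norm_add_sq[OF a hx(1)] by (simp add: L2_norm_sq)
  moreover have "(L2_norm (leb D) (\<lambda>z. h z x))\<^sup>2 \<le> (L2_norm (leb D) H)\<^sup>2"
    by (intro power_mono hx(2)) simp
  moreover have "(L2_norm (leb D) (\<lambda>z. a))\<^sup>2 = measure lborel D * (norm a)\<^sup>2"
    using measure_leb[OF D] by (simp add: L2_norm_sq)
  ultimately show "(LINT z|leb D. (norm (a + h z x))\<^sup>2)
      \<le> measure lborel D * (norm a)\<^sup>2 + (L2_norm (leb D) H)\<^sup>2"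
    by simp
qed

text \<open>\<psi> is a majorant of the new energy whose mean can be bounded. At the old nodes and
  over \<open>D\<close> the mean-zero property removes the cross terms. At the new node both
  summands depend on z, so the square is split crudely into 2 |e z|^2 + 2 (H z)^2; integrating 2
  |e|^2 and factoring out the volume is what raises \<mu> by 2 / |D|.\<close>

lemma quad_energy_step:
  fixes h :: "'a::euclidean_space \<Rightarrow> 'a \<Rightarrow> 'b::euclidean_space"
  assumes D: "compact D" and h: "error_field D h H" and Z: "finite Z" "Z \<subseteq> D"
    and pos: "measure lborel D > 0" and \<mu>: "0 \<le> \<mu>"
  obtains \<psi> where "integrable (leb D) \<psi>"
    "(LINT z|leb D. \<psi> z) \<le> measure lborel D * quad_energy D h (\<mu> + 2 / measure lborel D) Z
       + (real (card Z) + 2 + \<mu> * measure lborel D) * (L2_norm (leb D) H)\<^sup>2"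
    "\<And>z. z \<in> D - Z \<Longrightarrow> quad_energy D h \<mu> (insert z Z) \<le> \<psi> z"
proof -
  interpret pair_sigma_finite "leb D" "leb D"
    by (rule pair_sigma_finite_leb[OF D])
  interpret finite_measure "leb D"
    by (rule finite_measure_leb[OF D])
  define V where "V = measure lborel D"
  define C where "C = (L2_norm (leb D) H)\<^sup>2"
  define e where "e = quad_error h Z"
  have V: "measure (leb D) D = V" "V > 0"
    using measure_leb[OF D] pos by (simp_all add: V_def)
  have H: "H \<in> L2 (leb D)" and h_le: "\<And>z x. z \<in> D \<Longrightarrow> x \<in> D \<Longrightarrow> norm (h z x) \<le> H z"
    and h_meas [measurable]: "(\<lambda>p. h (fst p) (snd p)) \<in> borel_measurable (leb2 D)"
    using h by (auto simp: error_field_def)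
  have e: "e \<in> L2 (leb D)"
    unfolding e_def by (rule quad_error_L2[OF D h Z])
  note [measurable] = L2_borel_measurable[OF e] L2_borel_measurable[OF H]
  note int_e = L2_integrable_norm_sq[OF e]
  have int_H: "integrable (leb D) (\<lambda>z. (H z)\<^sup>2)" and C_eq: "(LINT z|leb D. (H z)\<^sup>2) = C"
    using L2_integrable_norm_sq[OF H] by (simp_all add: C_def L2_norm_sq)
  let ?\<phi> = "\<lambda>z x. (norm (e x + h z x))\<^sup>2"
  have "integrable (leb2 D) (\<lambda>p. 2 * (norm (e (snd p)))\<^sup>2 + 2 * (H (fst p))\<^sup>2)"
    using integrable_leb2_snd[OF D int_e] integrable_leb2_fst[OF D int_H] by simp
  then have int_\<phi>: "integrable (leb2 D) (\<lambda>(z, x). ?\<phi> z x)"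
  proof (rule Bochner_Integration.integrable_bound)
    show "AE p in leb2 D. norm (case p of (z, x) \<Rightarrow> ?\<phi> z x)
        \<le> norm (2 * (norm (e (snd p)))\<^sup>2 + 2 * (H (fst p))\<^sup>2)"
    proof (rule AE_I2)
      fix p assume "p \<in> space (leb2 D)"
      then have p: "fst p \<in> D" "snd p \<in> D"
        by (auto simp: space_pair_measure)
      have "(norm (h (fst p) (snd p)))\<^sup>2 \<le> (H (fst p))\<^sup>2"
        by (intro power_mono h_le p) simp
      then show "norm (case p of (z, x) \<Rightarrow> ?\<phi> z x)
          \<le> norm (2 * (norm (e (snd p)))\<^sup>2 + 2 * (H (fst p))\<^sup>2)"
        using norm_add_sq_le[of "e (snd p)" "h (fst p) (snd p)"] by (simp add: case_prod_beta')
    qed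
  qed measurable
  define \<psi> where "\<psi> z = (\<Sum>y\<in>Z. (norm (e y + h z y))\<^sup>2) + (2 * (norm (e z))\<^sup>2 + 2 * (H z)\<^sup>2)
      + \<mu> * (LINT x|leb D. ?\<phi> z x)" for z
  have int_1: "integrable (leb D) (\<lambda>z. \<Sum>y\<in>Z. (norm (e y + h z y))\<^sup>2)"
    using Z by (intro Bochner_Integration.integrable_sum error_field_average(1)[OF D h]) auto
  have int_2: "integrable (leb D) (\<lambda>z. 2 * (norm (e z))\<^sup>2 + 2 * (H z)\<^sup>2)"
    using int_e int_H by simp
  have int_3: "integrable (leb D) (\<lambda>z. LINT x|leb D. ?\<phi> z x)"
    using integrable_fst[OF int_\<phi>] .
  show ?thesis
  proof (rule that)
    show "integrable (leb D) \<psi>"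
      unfolding \<psi>_def using int_1 int_2 int_3 by simp
    have "(LINT z|leb D. (\<Sum>y\<in>Z. (norm (e y + h z y))\<^sup>2))
        = (\<Sum>y\<in>Z. LINT z|leb D. (norm (e y + h z y))\<^sup>2)"
      using Z by (intro Bochner_Integration.integral_sum error_field_average(1)[OF D h]) auto
    also have "\<dots> \<le> (\<Sum>y\<in>Z. V * (norm (e y))\<^sup>2 + C)"
      unfolding V_def C_def using Z by (intro sum_mono error_field_average(2)[OF D h]) auto
    finally have 1: "(LINT z|leb D. (\<Sum>y\<in>Z. (norm (e y + h z y))\<^sup>2))
        \<le> V * (\<Sum>y\<in>Z. (norm (e y))\<^sup>2) + card Z * C"
      by (simp add: sum.distrib sum_distrib_left)
    have 2: "(LINT z|leb D. 2 * (norm (e z))\<^sup>2 + 2 * (H z)\<^sup>2) = 2 * (L2_norm (leb D) e)\<^sup>2 + 2 * C"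
      using int_e int_H by (simp add: C_eq L2_norm_sq)
    have "(LINT z|leb D. LINT x|leb D. ?\<phi> z x) = (LINT x|leb D. LINT z|leb D. ?\<phi> z x)"
      by (rule Fubini_integral[OF int_\<phi>, symmetric])
    also have "\<dots> \<le> (LINT x|leb D. V * (norm (e x))\<^sup>2 + C)"
      using integrable_snd[OF int_\<phi>] int_e error_field_average(2)[OF D h]
      by (intro integral_mono) (auto simp: V_def C_def)
    also have "\<dots> = V * (L2_norm (leb D) e)\<^sup>2 + V * C"
      using int_e by (simp add: L2_norm_sq V)
    finally have 3: "\<mu> * (LINT z|leb D. LINT x|leb D. ?\<phi> z x)
        \<le> \<mu> * (V * (L2_norm (leb D) e)\<^sup>2 + V * C)"
      using \<mu> by (rule mult_left_mono)
    have "(LINT z|leb D. \<psi> z) = (LINT z|leb D. (\<Sum>y\<in>Z. (norm (e y + h z y))\<^sup>2))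
        + (LINT z|leb D. 2 * (norm (e z))\<^sup>2 + 2 * (H z)\<^sup>2) + \<mu> * (LINT z|leb D. LINT x|leb D. ?\<phi> z x)"
      unfolding \<psi>_def using int_1 int_2 int_3 by simp
    also have "\<dots> \<le> (V * (\<Sum>y\<in>Z. (norm (e y))\<^sup>2) + card Z * C)
        + (2 * (L2_norm (leb D) e)\<^sup>2 + 2 * C) + \<mu> * (V * (L2_norm (leb D) e)\<^sup>2 + V * C)"
      using 1 2 3 by linarith
    also have "\<dots> = V * quad_energy D h (\<mu> + 2 / V) Z + (real (card Z) + 2 + \<mu> * V) * C"
      using V(2) by (simp add: quad_energy_def e_def algebra_simps)
    finally show "(LINT z|leb D. \<psi> z) \<le> measure lborel D * quad_energy D h (\<mu> + 2 / measure lborel D) Z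
       + (real (card Z) + 2 + \<mu> * measure lborel D) * (L2_norm (leb D) H)\<^sup>2"
      by (simp only: V_def C_def)
    fix z assume z: "z \<in> D - Z"
    have ins: "quad_error h (insert z Z) x = e x + h z x" for x
      using z Z by (simp add: quad_error_def e_def add.commute)
    have "(norm (h z z))\<^sup>2 \<le> (H z)\<^sup>2"
      using z by (intro power_mono h_le) auto
    then have "(norm (e z + h z z))\<^sup>2 \<le> 2 * (norm (e z))\<^sup>2 + 2 * (H z)\<^sup>2"
      using norm_add_sq_le[of "e z" "h z z"] by simp
    then show "quad_energy D h \<mu> (insert z Z) \<le> \<psi> z"
      using z Z by (simp add: quad_energy_def ins \<psi>_def L2_norm_sq)
  qed
qed

text \<open>
  Derandomised Monte Carlo: the nodes are chosen one after the other, each not worse than the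
  average over \<open>D\<close>. Since the next node is itself added to the evaluation points, the weight
  \<open>\<mu>\<close> of the mean square error has to decrease by \<open>2 / |D|\<close> in every step.
\<close>

lemma exists_nodes:
  fixes h :: "'i \<Rightarrow> 'a::euclidean_space \<Rightarrow> 'a \<Rightarrow> 'b::euclidean_space"
  assumes D: "compact D" and I: "finite I" and h: "\<And>i. i \<in> I \<Longrightarrow> error_field D (h i) (H i)"
    and pos: "measure lborel D > 0" and \<mu>: "0 \<le> \<mu>"
  shows "\<exists>Z\<subseteq>D. finite Z \<and> card Z = n \<and> (\<Sum>i\<in>I. quad_energy D (h i) \<mu> Z)
    \<le> real n * (\<Sum>i\<in>I. (L2_norm (leb D) (H i))\<^sup>2) * (\<mu> + 3 * (real n + 1) / measure lborel D)"
  using \<mu>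
proof (induction n arbitrary: \<mu>)
  case 0
  show ?case
    by (intro exI[of _ "{}"]) (simp add: quad_energy_def quad_error_def[abs_def])
next
  case (Suc n)
  define V where "V = measure lborel D"
  define C where "C = (\<Sum>i\<in>I. (L2_norm (leb D) (H i))\<^sup>2)"
  have V: "V > 0" "measure (leb D) (space (leb D)) = V"
    using pos measure_leb[OF D] by (simp_all add: V_def)
  have C: "0 \<le> C"
    by (simp add: C_def sum_nonneg)
  obtain Z where Z: "Z \<subseteq> D" "finite Z" "card Z = n"
    and Z_le: "(\<Sum>i\<in>I. quad_energy D (h i) (\<mu> + 2 / V) Z) \<le> real n * C * (\<mu> + 2 / V + 3 * (real n + 1) / V)"
    using Suc.IH[of "\<mu> + 2 / V"] Suc.prems V by (auto simp: V_def C_def)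
  have "\<exists>\<psi>. integrable (leb D) \<psi> \<and>
      (LINT z|leb D. \<psi> z) \<le> V * quad_energy D (h i) (\<mu> + 2 / V) Z
        + (real n + 2 + \<mu> * V) * (L2_norm (leb D) (H i))\<^sup>2 \<and>
      (\<forall>z\<in>D - Z. quad_energy D (h i) \<mu> (insert z Z) \<le> \<psi> z)" if "i \<in> I" for i
    using quad_energy_step[OF D h[OF that] Z(2,1) pos Suc.prems] Z(3) unfolding V_def by metis
  then obtain \<psi> where \<psi>: "\<And>i. i \<in> I \<Longrightarrow> integrable (leb D) (\<psi> i)"
    and \<psi>_int: "\<And>i. i \<in> I \<Longrightarrow> (LINT z|leb D. \<psi> i z) \<le> V * quad_energy D (h i) (\<mu> + 2 / V) Z
        + (real n + 2 + \<mu> * V) * (L2_norm (leb D) (H i))\<^sup>2"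
    and \<psi>_le: "\<And>i z. i \<in> I \<Longrightarrow> z \<in> D - Z \<Longrightarrow> quad_energy D (h i) \<mu> (insert z Z) \<le> \<psi> i z"
    by metis
  define b where "b = (\<Sum>i\<in>I. quad_energy D (h i) (\<mu> + 2 / V) Z) + ((real n + 2) / V + \<mu>) * C"
  have "(LINT z|leb D. (\<Sum>i\<in>I. \<psi> i z)) = (\<Sum>i\<in>I. LINT z|leb D. \<psi> i z)"
    by (rule Bochner_Integration.integral_sum) (rule \<psi>)
  also have "\<dots> \<le> (\<Sum>i\<in>I. V * quad_energy D (h i) (\<mu> + 2 / V) Z
        + (real n + 2 + \<mu> * V) * (L2_norm (leb D) (H i))\<^sup>2)"
    by (intro sum_mono \<psi>_int)
  also have "\<dots> = V * (\<Sum>i\<in>I. quad_energy D (h i) (\<mu> + 2 / V) Z) + (real n + 2 + \<mu> * V) * C"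
    by (simp add: sum.distrib sum_distrib_left C_def)
  also have "\<dots> = b * V"
    using V by (simp add: b_def field_simps)
  finally have avg: "(LINT z|leb D. (\<Sum>i\<in>I. \<psi> i z)) \<le> b * measure (leb D) (space (leb D))"
    by (simp only: V)
  \<comment> \<open>A finite grid is a null set, so the next node can be new. This makes the
    cardinality grow and keeps z where the majorants \<psi> are valid.\<close>
  have "AE z in lborel. z \<notin> Z"
    using finite_imp_null_set_lborel[OF Z(2)] by (rule AE_not_in)
  then have "AE z in leb D. z \<notin> Z"
    using D by (subst AE_restrict_space_iff) (auto simp: compact_imp_closed)
  from exists_le_average[OF finite_measure_leb[OF D] _ _ avg this] obtain z
    where z: "z \<in> D - Z" and z_le: "(\<Sum>i\<in>I. \<psi> i z) \<le> b"
    using V \<psi> by auto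
  have "(\<Sum>i\<in>I. quad_energy D (h i) \<mu> (insert z Z)) \<le> (\<Sum>i\<in>I. \<psi> i z)"
    by (intro sum_mono \<psi>_le z)
  also have "\<dots> \<le> b"
    by (rule z_le)
  \<comment> \<open>The induction bound at weight \<mu> + 2 / V together with the new terms gives 3
    n^2 + 6 n + 2 over V; the claim allows 3 (n + 1) (n + 2) = 3 n^2 + 9 n + 6.\<close>
  also have "b \<le> real n * C * (\<mu> + 2 / V + 3 * (real n + 1) / V) + ((real n + 2) / V + \<mu>) * C"
    using Z_le by (simp add: b_def)
  also have "\<dots> = C * ((real n + 1) * \<mu> + (3 * (real n)\<^sup>2 + 6 * real n + 2) / V)"
    using V by (simp add: field_simps power2_eq_square)
  also have "\<dots> \<le> C * ((real n + 1) * \<mu> + (3 * (real n)\<^sup>2 + 9 * real n + 6) / V)"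
    using V C by (intro mult_left_mono add_left_mono divide_right_mono) auto
  also have "\<dots> = real (Suc n) * C * (\<mu> + 3 * (real (Suc n) + 1) / V)"
    using V by (simp add: field_simps power2_eq_square)
  finally have "(\<Sum>i\<in>I. quad_energy D (h i) \<mu> (insert z Z))
      \<le> real (Suc n) * C * (\<mu> + 3 * (real (Suc n) + 1) / V)" .
  moreover have "insert z Z \<subseteq> D" "finite (insert z Z)" "card (insert z Z) = Suc n"
    using Z z by auto
  ultimately show ?case
    unfolding V_def C_def by blast
qed

lemma quad_energy_nonneg: "0 \<le> \<mu> \<Longrightarrow> 0 \<le> quad_energy D h \<mu> Z"
  by (simp add: quad_energy_def sum_nonneg)

text \<open>The weight \<mu> = n / |D| balances the two parts of the energy, which is then at most 7
  C n^2 / |D|, by 4 n + 3 \<le> 7 n. The accumulated error thus has norm O(n^(1/2)) over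
  \<open>D\<close> and, by Cauchy--Schwarz, absolute sum O(n^(3/2)) over the nodes, each a factor
  n^(1/2) below what is allowed. The bounds are stated with \<open>card Z + 1\<close> because the
  network adjoins its evaluation point.\<close>

lemma exists_accurate_nodes:
  fixes h :: "'i \<Rightarrow> 'a::euclidean_space \<Rightarrow> 'a \<Rightarrow> 'b::euclidean_space"
  assumes D: "compact D" and I: "finite I" and h: "\<And>i. i \<in> I \<Longrightarrow> error_field D (h i) (H i)"
    and pos: "measure lborel D > 0" and \<eta>: "0 < \<eta>"
  obtains Z where "finite Z" "Z \<subseteq> D"
    "\<And>i. i \<in> I \<Longrightarrow> L2_norm (leb D) (quad_error (h i) Z) \<le> \<eta> * (real (card Z) + 1)"
    "\<And>i. i \<in> I \<Longrightarrow> L2_norm (leb D) (H i) \<le> \<eta> * (real (card Z) + 1)"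
    "\<And>i. i \<in> I \<Longrightarrow> (\<Sum>y\<in>Z. norm (quad_error (h i) Z y)) \<le> \<eta> * (real (card Z) + 1)\<^sup>2"
proof -
  define V where "V = measure lborel D"
  define C where "C = (\<Sum>i\<in>I. (L2_norm (leb D) (H i))\<^sup>2)"
  have V: "V > 0"
    using pos by (simp add: V_def)
  have C: "0 \<le> C"
    by (simp add: C_def sum_nonneg)
  obtain n :: nat where n: "max 1 (max (7 * C / \<eta>\<^sup>2) (7 * C / V / \<eta>\<^sup>2)) \<le> real n"
    using real_arch_simple by blast
  then have n1: "1 \<le> real n"
    by simp
  have nC: "7 * C \<le> \<eta>\<^sup>2 * n" "7 * C / V \<le> \<eta>\<^sup>2 * n"
    using n \<eta> pos_divide_le_eq[of "\<eta>\<^sup>2" "7 * C" n] pos_divide_le_eq[of "\<eta>\<^sup>2" "7 * C / V" n]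
    by (simp_all only: max.bounded_iff zero_less_power mult.commute[of _ "\<eta>\<^sup>2"] simp_thms)
  have pow: "\<eta>\<^sup>2 * n \<le> (\<eta> * (real n + 1))\<^sup>2" "\<eta>\<^sup>2 * n * n \<le> (\<eta> * (real n + 1))\<^sup>2"
    "real n * (\<eta>\<^sup>2 * n * (real n)\<^sup>2) \<le> (\<eta> * (real n + 1)\<^sup>2)\<^sup>2"
  proof -
    show 2: "\<eta>\<^sup>2 * n * n \<le> (\<eta> * (real n + 1))\<^sup>2"
      unfolding power_mult_distrib mult.assoc
      by (intro mult_left_mono) (simp_all add: power2_eq_square algebra_simps)
    have "\<eta>\<^sup>2 * n * 1 \<le> \<eta>\<^sup>2 * n * n"
      using n1 by (intro mult_left_mono) simp_all
    with 2 show "\<eta>\<^sup>2 * n \<le> (\<eta> * (real n + 1))\<^sup>2"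
      by simp
    have "real n * (\<eta>\<^sup>2 * n * (real n)\<^sup>2) = \<eta>\<^sup>2 * (real n ^ 2) ^ 2"
      by (simp add: power2_eq_square mult_ac)
    also have "\<dots> \<le> \<eta>\<^sup>2 * ((real n + 1) ^ 2) ^ 2"
      by (intro mult_left_mono power_mono) simp_all
    finally show "real n * (\<eta>\<^sup>2 * n * (real n)\<^sup>2) \<le> (\<eta> * (real n + 1)\<^sup>2)\<^sup>2"
      by (simp only: power_mult_distrib)
  qed
  have "\<exists>Z\<subseteq>D. finite Z \<and> card Z = n \<and> (\<Sum>i\<in>I. quad_energy D (h i) (real n / V) Z)
      \<le> real n * C * (real n / V + 3 * (real n + 1) / V)"
    unfolding V_def C_def by (rule exists_nodes[OF D I h pos]) (use pos in simp_all)
  then obtain Z where Z: "Z \<subseteq> D" "finite Z" "card Z = n"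
    and le: "(\<Sum>i\<in>I. quad_energy D (h i) (real n / V) Z) \<le> real n * C * (real n / V + 3 * (real n + 1) / V)"
    by blast
  have energy: "quad_energy D (h i) (real n / V) Z \<le> 7 * C * (real n)\<^sup>2 / V" if "i \<in> I" for i
  proof -
    have "quad_energy D (h i) (real n / V) Z \<le> (\<Sum>i\<in>I. quad_energy D (h i) (real n / V) Z)"
      using V by (intro member_le_sum[OF that] I quad_energy_nonneg) simp
    also note le
    also have "real n * C * (real n / V + 3 * (real n + 1) / V) = (real n * C / V) * (4 * real n + 3)"
      using V by (simp add: field_simps)
    also have "\<dots> \<le> (real n * C / V) * (7 * real n)"
      using n1 C V by (intro mult_left_mono) auto
    finally show ?thesis
      by (simp add: power2_eq_square mult_ac)
  qed
  show ?thesis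
  proof (rule that[OF Z(2,1)])
    fix i assume i: "i \<in> I"
    let ?e = "quad_error (h i) Z"
    have "(L2_norm (leb D) (H i))\<^sup>2 \<le> C"
      unfolding C_def by (rule member_le_sum[OF i _ I]) simp
    also have "\<dots> \<le> \<eta>\<^sup>2 * n"
      using nC C by simp
    also have "\<dots> \<le> (\<eta> * (real (card Z) + 1))\<^sup>2"
      using pow(1) Z by simp
    finally show "L2_norm (leb D) (H i) \<le> \<eta> * (real (card Z) + 1)"
      by (rule power2_le_imp_le) (use \<eta> in simp)
    have "real n / V * (L2_norm (leb D) ?e)\<^sup>2 \<le> quad_energy D (h i) (real n / V) Z"
      by (simp add: quad_energy_def sum_nonneg)
    also note energy[OF i]
    also have "7 * C * (real n)\<^sup>2 / V = real n / V * (7 * C * real n)"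
      by (simp add: power2_eq_square)
    finally have "(L2_norm (leb D) ?e)\<^sup>2 \<le> 7 * C * real n"
      using n1 V by (subst (asm) mult_le_cancel_left_pos) simp_all
    also have "\<dots> \<le> \<eta>\<^sup>2 * n * real n"
      by (intro mult_right_mono nC) simp
    also have "\<dots> \<le> (\<eta> * (real (card Z) + 1))\<^sup>2"
      using pow(2) Z by simp
    finally show "L2_norm (leb D) ?e \<le> \<eta> * (real (card Z) + 1)"
      by (rule power2_le_imp_le) (use \<eta> in simp)
    have "(\<Sum>y\<in>Z. norm (?e y))\<^sup>2 \<le> real (card Z) * (\<Sum>y\<in>Z. (norm (?e y))\<^sup>2)"
      using sum_squared_le_sum_of_squares[of "\<lambda>y. norm (?e y)" Z] Z by (simp add: mult.commute)
    also have "(\<Sum>y\<in>Z. (norm (?e y))\<^sup>2) \<le> quad_energy D (h i) (real n / V) Z"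
      using V by (simp add: quad_energy_def)
    also note energy[OF i]
    also have "7 * C * (real n)\<^sup>2 / V = 7 * C / V * (real n)\<^sup>2"
      by simp
    also have "7 * C / V * (real n)\<^sup>2 \<le> \<eta>\<^sup>2 * n * (real n)\<^sup>2"
      by (intro mult_right_mono nC) simp
    also have "real (card Z) * (\<eta>\<^sup>2 * n * (real n)\<^sup>2) \<le> (\<eta> * (real (card Z) + 1)\<^sup>2)\<^sup>2"
      using pow(3) Z by simp
    finally show "(\<Sum>y\<in>Z. norm (?e y)) \<le> \<eta> * (real (card Z) + 1)\<^sup>2"
      by (rule power2_le_imp_le) (use \<eta> in \<open>simp_all add: mult_left_mono\<close>)
  qed
qed

section \<open>Fredholm neural networks\<close>

text \<open>Scaled by the volume so that the sum over N nodes, divided by N, is the quadrature rule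
  of weight |D| / N minus the integral. The node comes first and the evaluation point second, the
  reverse of their order in \<open>k\<close>.\<close>

definition kernel_error ::
    "'a::euclidean_space set \<Rightarrow> ('a \<times> 'a \<Rightarrow> real) \<Rightarrow> ('a \<Rightarrow> 'b::euclidean_space) \<Rightarrow> 'a \<Rightarrow> 'a \<Rightarrow> 'b" where
  "kernel_error D k f z x = (measure lborel D * k (x, z)) *\<^sub>R f z - int_op D k f x"

text \<open>The mean over the node vanishes because both parts integrate to |D| times
  \<open>int_op D k f x\<close>. The bound on k holds at every point, so the domination covers the
  diagonal and the sections are square-integrable for every x, not merely almost every x.\<close>

lemma kernel_error_field:
  fixes f :: "'a::euclidean_space \<Rightarrow> 'b::euclidean_space"
  assumes D: "compact D" and k: "k \<in> L2 (leb2 D)" and f: "f \<in> L2 (leb D)"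
    and B: "\<And>x z. x \<in> D \<Longrightarrow> z \<in> D \<Longrightarrow> \<bar>k (x, z)\<bar> \<le> B"
  shows "error_field D (kernel_error D k f)
    (\<lambda>z. measure lborel D * B * norm (f z) + B * (LINT z|leb D. norm (f z)))"
proof -
  note [measurable] = L2_borel_measurable[OF k] L2_borel_measurable[OF f]
    int_op_measurable[OF D L2_borel_measurable[OF k] L2_borel_measurable[OF f]]
  note fin = finite_measure_leb[OF D]
  have sec: "(\<lambda>z. k (x, z)) \<in> L2 (leb D)" if x: "x \<in> D" for x
  proof (rule L2_bound[OF L2_const[OF fin, of B] kernel_section_measurable[OF L2_borel_measurable[OF k] x]])
    show "AE z in leb D. norm (k (x, z)) \<le> norm B"
      using AE_space
    proof eventually_elim
      case (elim z)
      then show ?case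
        using B[OF x, of z] by simp
    qed
  qed
  note int = L2_scaleR_integrable[OF sec f]
  have int_f: "integrable (leb D) (\<lambda>z. norm (f z))"
    by (rule L2_integrable[OF fin L2_norm_fun[OF f]])
  have T_le: "norm (int_op D k f x) \<le> B * (LINT z|leb D. norm (f z))" if x: "x \<in> D" for x
  proof -
    have "norm (int_op D k f x) \<le> (LINT z|leb D. norm (k (x, z) *\<^sub>R f z))"
      unfolding int_op_def by (rule integral_norm_bound)
    also have "\<dots> \<le> (LINT z|leb D. B * norm (f z))"
    proof (rule integral_mono)
      fix z assume "z \<in> space (leb D)"
      then show "norm (k (x, z) *\<^sub>R f z) \<le> B * norm (f z)"
        using B[OF x, of z] by (simp add: mult_right_mono)
    qed (rule integrable_norm[OF int[OF x]], use int_f in simp)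
    finally show ?thesis
      by simp
  qed
  show ?thesis
    unfolding error_field_def
  proof (intro conjI ballI)
    show "(\<lambda>p. kernel_error D k f (fst p) (snd p)) \<in> borel_measurable (leb2 D)"
      unfolding kernel_error_def by measurable
    show "(\<lambda>z. measure lborel D * B * norm (f z) + B * (LINT z|leb D. norm (f z))) \<in> L2 (leb D)"
      using L2_add[OF L2_scaleR[OF L2_norm_fun[OF f]] L2_const[OF fin], of "measure lborel D * B"]
      by simp
    fix z x assume z: "z \<in> D" and x: "x \<in> D"
    have "norm ((measure lborel D * k (x, z)) *\<^sub>R f z) \<le> measure lborel D * B * norm (f z)"
      using B[OF x z] by (simp add: abs_mult mult_left_mono mult_right_mono)
    then show "norm (kernel_error D k f z x) \<le> measure lborel D * B * norm (f z) + B * (LINT z|leb D. norm (f z))"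
      unfolding kernel_error_def
      by (intro order_trans[OF norm_triangle_ineq4] add_mono T_le x)
  next
    fix x assume x: "x \<in> D"
    interpret finite_measure "leb D"
      by (rule fin)
    have "(LINT z|leb D. kernel_error D k f z x)
        = (LINT z|leb D. measure lborel D *\<^sub>R (k (x, z) *\<^sub>R f z)) - (LINT z|leb D. int_op D k f x)"
      unfolding kernel_error_def scaleR_scaleR[symmetric]
      by (intro Bochner_Integration.integral_diff integrable_scaleR_right int x integrable_const)
    also have "\<dots> = measure lborel D *\<^sub>R int_op D k f x - measure lborel D *\<^sub>R int_op D k f x"
      by (simp add: measure_leb[OF D] int_op_def del: scaleR_scaleR)
    finally show "(LINT z|leb D. kernel_error D k f z x) = 0"
      by simp
  qed
qed

text \<open>
  On the grid \<open>P\<close> the network and the exact iteration differ by the accumulated quadrature errors;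
  the mean over the nodes is what the discrete operator propagates.
\<close>

lemma fnn_hidden_km_iterate_error:
  fixes g :: "'a::euclidean_space \<Rightarrow> 'b::euclidean_space" and D P :: "'a set"
    and k :: "'a \<times> 'a \<Rightarrow> real" and B :: real
  defines "V \<equiv> measure lborel D"
    and "r \<equiv> \<lambda>l y. norm (quad_error (kernel_error D k (km_iterate D k g l)) P y) / real (card P)"
  assumes P: "finite P" "P \<noteq> {}" and B: "\<And>y w. y \<in> P \<Longrightarrow> w \<in> P \<Longrightarrow> \<bar>k (y, w)\<bar> \<le> B"
    and x: "x \<in> P"
  shows "norm (fnn_hidden (1/2) (V / real (card P)) P k g m x - km_iterate D k g m x)
    \<le> (\<Sum>l<m. r l x + (1 + V * B) ^ m * ((\<Sum>y\<in>P. r l y) / real (card P)))"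
proof -
  define N where "N = real (card P)"
  define F where "F = km_iterate D k g"
  define v where "v = fnn_hidden (1/2) (V / N) P k g"
  define e where "e m y = v m y - F m y" for m y
  define a where "a m = (\<Sum>y\<in>P. norm (e m y)) / N" for m
  define \<rho> where "\<rho> l = (\<Sum>y\<in>P. r l y) / N" for l
  have N: "N > 0"
    using P by (simp add: N_def card_gt_0_iff)
  have V: "0 \<le> V"
    by (simp add: V_def)
  have B0: "0 \<le> B"
    using B[OF x x] by linarith
  define Q where "Q = 1 + V * B"
  have Q: "1 \<le> Q"
    using V B0 by (simp add: Q_def)
  have r_nonneg: "0 \<le> r l y" for l y
    by (simp add: r_def)
  have \<rho>_nonneg: "0 \<le> \<rho> l" for l
    using N by (simp add: \<rho>_def r_nonneg sum_nonneg)
  \<comment> \<open>The factor 1/2 of the relaxation is given away: no contraction is sought here,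
    since the growth factor \<open>Q ^ m\<close> does not depend on the number of nodes and is a
    constant once the depth is fixed.\<close>
  have err: "norm (e (Suc m) y) \<le> norm (e m y) + V * B * a m + r m y" if y: "y \<in> P" for m y
  proof -
    define K where "K u = (\<Sum>w\<in>P. (V / N * k (y, w)) *\<^sub>R u w)" for u :: "'a \<Rightarrow> 'b"
    have "v (Suc m) y = (1/2) *\<^sub>R g y + (\<Sum>w\<in>P. (1/2) *\<^sub>R ((V / N * k (y, w)) *\<^sub>R v m w)
        + (1/2) *\<^sub>R (of_bool (w = y) *\<^sub>R v m w))"
      by (simp add: v_def scaleR_add_left mult_ac)
    also have "\<dots> = (1/2) *\<^sub>R g y + ((1/2) *\<^sub>R K (v m) + (1/2) *\<^sub>R (\<Sum>w\<in>P. of_bool (w = y) *\<^sub>R v m w))"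
      by (simp only: sum.distrib scaleR_sum_right[symmetric] K_def)
    also have "(\<Sum>w\<in>P. of_bool (w = y) *\<^sub>R v m w) = (\<Sum>w\<in>P. if w = y then v m w else 0)"
      by (intro sum.cong) auto
    also have "\<dots> = v m y"
      using P(1) y by simp
    finally have v_Suc: "v (Suc m) y = (1/2) *\<^sub>R (g y + v m y + K (v m))"
      by (simp add: scaleR_add_right)
    have F_Suc: "F (Suc m) y = (1/2) *\<^sub>R (g y + F m y + int_op D k (F m) y)"
      by (simp add: F_def averaged_op_def scaleR_add_right)
    have K_err: "K (F m) - int_op D k (F m) y = (1 / N) *\<^sub>R quad_error (kernel_error D k (F m)) P y"
    proof -
      have "quad_error (kernel_error D k (F m)) P y
          = (\<Sum>w\<in>P. (V * k (y, w)) *\<^sub>R F m w) - N *\<^sub>R int_op D k (F m) y"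
        by (simp add: quad_error_def kernel_error_def sum_subtractf V_def N_def sum_constant_scaleR)
      then show ?thesis
        using N by (simp add: scaleR_diff_right K_def scaleR_sum_right)
    qed
    have K_diff: "K (v m) = K (F m) + K (e m)"
      by (simp add: K_def e_def sum_subtractf scaleR_diff_right)
    have "e (Suc m) y = (1/2) *\<^sub>R (e m y + K (e m) + (1 / N) *\<^sub>R quad_error (kernel_error D k (F m)) P y)"
      unfolding e_def[of "Suc m" y] v_Suc F_Suc K_diff K_err[symmetric] e_def[of m y]
      by (simp add: scaleR_diff_right[symmetric] algebra_simps)
    then have "norm (e (Suc m) y) \<le> norm (e m y + K (e m) + (1 / N) *\<^sub>R quad_error (kernel_error D k (F m)) P y)"
      by simp
    also have "\<dots> \<le> norm (e m y) + norm (K (e m)) + r m y"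
      by (rule order_trans[OF norm_triangle_ineq add_mono[OF norm_triangle_ineq]])
        (simp add: r_def F_def N_def)
    also have "norm (K (e m)) \<le> (\<Sum>w\<in>P. V / N * B * norm (e m w))"
      unfolding K_def
    proof (rule order_trans[OF norm_sum sum_mono])
      fix w assume w: "w \<in> P"
      have "\<bar>V / N * k (y, w)\<bar> \<le> V / N * B"
        using B[OF y w] V N by (simp add: abs_mult divide_right_mono mult_left_mono)
      then show "norm ((V / N * k (y, w)) *\<^sub>R e m w) \<le> V / N * B * norm (e m w)"
        using mult_right_mono[OF _ norm_ge_zero] by (simp only: norm_scaleR)
    qed
    also have "\<dots> = V * B * a m"
      by (simp only: a_def sum_distrib_left[symmetric]) simp
    finally show ?thesis
      by simp
  qed
  \<comment> \<open>Averaging \<open>err\<close> over the grid closes the recursion: the next mean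
    is at most Q times the last plus \<open>\<rho> m\<close>. It starts at 0, as network and
    iteration agree at index 0, and all powers of Q are rounded up to \<open>Q ^ m\<close>.\<close>
  have a_le: "a m \<le> Q ^ m * (\<Sum>l<m. \<rho> l)" for m
  proof (induction m)
    case 0
    show ?case
      by (simp add: a_def e_def v_def F_def)
  next
    case (Suc m)
    have "a (Suc m) \<le> (\<Sum>y\<in>P. norm (e m y) + V * B * a m + r m y) / N"
      unfolding a_def[of "Suc m"] using N by (intro divide_right_mono sum_mono err) auto
    also have "(\<Sum>y\<in>P. norm (e m y) + V * B * a m + r m y)
        = (\<Sum>y\<in>P. norm (e m y)) + N * (V * B * a m) + (\<Sum>y\<in>P. r m y)"
      by (simp add: sum.distrib N_def)
    also have "\<dots> / N = Q * a m + \<rho> m"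
      using N by (simp add: add_divide_distrib a_def[of m] \<rho>_def Q_def distrib_right)
    also have "\<dots> \<le> Q * (Q ^ m * (\<Sum>l<m. \<rho> l)) + Q ^ Suc m * \<rho> m"
    proof (rule add_mono)
      show "Q * a m \<le> Q * (Q ^ m * (\<Sum>l<m. \<rho> l))"
        using Q by (intro mult_left_mono Suc.IH) simp
      show "\<rho> m \<le> Q ^ Suc m * \<rho> m"
        using mult_right_mono[OF one_le_power[OF Q, of "Suc m"] \<rho>_nonneg[of m]] by simp
    qed
    finally show ?case
      by (simp add: algebra_simps)
  qed
  have "norm (e m x) \<le> (\<Sum>l<m. r l x + Q ^ m * \<rho> l)"
  proof (induction m)
    case 0
    show ?case
      by (simp add: e_def v_def F_def)
  next
    case (Suc m)
    have "norm (e (Suc m) x) \<le> norm (e m x) + V * B * a m + r m x"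
      by (rule err[OF x])
    also have "\<dots> \<le> (\<Sum>l<m. r l x + Q ^ m * \<rho> l) + V * B * (Q ^ m * (\<Sum>l<m. \<rho> l)) + r m x"
      using V B0 by (intro add_mono Suc.IH mult_left_mono a_le) auto
    also have "\<dots> = (\<Sum>l<m. r l x) + Q ^ Suc m * (\<Sum>l<m. \<rho> l) + r m x"
      by (simp add: sum.distrib sum_distrib_left[symmetric]) (simp add: Q_def algebra_simps)
    also have "\<dots> \<le> (\<Sum>l<m. r l x) + Q ^ Suc m * (\<Sum>l<m. \<rho> l) + r m x + Q ^ Suc m * \<rho> m"
      using Q \<rho>_nonneg by simp
    also have "\<dots> = (\<Sum>l<Suc m. r l x + Q ^ Suc m * \<rho> l)"
      by (simp only: sum.lessThan_Suc sum.distrib sum_distrib_left[symmetric]) (simp only: algebra_simps)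
    finally show ?case .
  qed
  then show ?thesis
    by (simp add: e_def v_def F_def Q_def \<rho>_def N_def)
qed

text \<open>The output formula has the shape of a hidden layer, and x lies in the grid
  \<open>insert x Z\<close>. With m + 1 layers the output reads the hidden index m - 1, so it is the
  hidden value of index m at x.\<close>

lemma fnn_on_eq_hidden:
  "fnn_on D \<kappa> (m + 1) Z k g x = fnn_hidden \<kappa> (measure lborel D / real (card (insert x Z))) (insert x Z) k g m x"
  if "1 \<le> m"
  using that by (cases m) (simp_all add: fnn_on_def fnn_def)

text \<open>The grid moves with x, so measurability is not visible from the formula. Off
  \<open>Z\<close> the number of nodes, and so the weight, is constant, and induction over the
  layers shows that the values at x and at each fixed node depend measurably on x. Values on the
  finite set \<open>Z\<close> do not affect measurability.\<close>

lemma fnn_on_measurable: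
  fixes g :: "'a::euclidean_space \<Rightarrow> 'b::euclidean_space"
  assumes D: "compact D" and k [measurable]: "k \<in> borel_measurable (leb2 D)"
    and g [measurable]: "g \<in> borel_measurable (leb D)" and Z: "finite Z" "Z \<subseteq> D" and m: "1 \<le> m"
  shows "fnn_on D \<kappa> (m + 1) Z k g \<in> borel_measurable (leb D)"
proof -
  define \<Delta> where "\<Delta> = measure lborel D / real (card Z + 1)"
  have diag [measurable]: "(\<lambda>x. k (x, x)) \<in> borel_measurable (leb D)"
    by measurable
  have sec1 [measurable]: "(\<lambda>x. k (y, x)) \<in> borel_measurable (leb D)" if "y \<in> D" for y
    by (rule kernel_section_measurable[OF k that])
  have sec2 [measurable]: "(\<lambda>x. k (x, w)) \<in> borel_measurable (leb D)" if "w \<in> D" for w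
    using measurable_compose[OF measurable_Pair2'[of w "leb D" "leb D"] k] that by simp
  have "\<exists>\<phi> \<psi>. \<phi> \<in> borel_measurable (leb D) \<and> (\<forall>y\<in>Z. \<psi> y \<in> borel_measurable (leb D)) \<and>
      (\<forall>x\<in>D - Z. fnn_hidden \<kappa> \<Delta> (insert x Z) k g m x = \<phi> x \<and>
         (\<forall>y\<in>Z. fnn_hidden \<kappa> \<Delta> (insert x Z) k g m y = \<psi> y x))" for m
  proof (induction m)
    case 0
    show ?case
      by (intro exI[of _ "\<lambda>x. \<kappa> *\<^sub>R g x"] exI[of _ "\<lambda>y x. \<kappa> *\<^sub>R g y"]) auto
  next
    case (Suc m)
    then obtain \<phi> \<psi> where \<phi>: "\<phi> \<in> borel_measurable (leb D)"
      and \<psi>0: "\<forall>y\<in>Z. \<psi> y \<in> borel_measurable (leb D)"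
      and eq0: "\<forall>x\<in>D - Z. fnn_hidden \<kappa> \<Delta> (insert x Z) k g m x = \<phi> x \<and>
         (\<forall>y\<in>Z. fnn_hidden \<kappa> \<Delta> (insert x Z) k g m y = \<psi> y x)"
      by (elim exE conjE)
    have \<psi>: "\<psi> y \<in> borel_measurable (leb D)" if "y \<in> Z" for y
      using \<psi>0 that by (rule bspec)
    have eq: "fnn_hidden \<kappa> \<Delta> (insert x Z) k g m x = \<phi> x"
        "y \<in> Z \<Longrightarrow> fnn_hidden \<kappa> \<Delta> (insert x Z) k g m y = \<psi> y x" if "x \<in> D - Z" for x y
      using eq0 that by simp_all
    let ?w = "\<lambda>z y. k (z, y) * \<kappa> * \<Delta> + (1 - \<kappa>) * of_bool (y = z)"
    let ?\<phi> = "\<lambda>x. \<kappa> *\<^sub>R g x + ((k (x, x) * \<kappa> * \<Delta> + (1 - \<kappa>)) *\<^sub>R \<phi> x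
        + (\<Sum>w\<in>Z. (k (x, w) * \<kappa> * \<Delta>) *\<^sub>R \<psi> w x))"
    let ?\<psi> = "\<lambda>y x. \<kappa> *\<^sub>R g y + ((k (y, x) * \<kappa> * \<Delta>) *\<^sub>R \<phi> x
        + (\<Sum>w\<in>Z. ?w y w *\<^sub>R \<psi> w x))"
    have ZD: "w \<in> D" if "w \<in> Z" for w
      using Z that by auto
    have \<phi>': "?\<phi> \<in> borel_measurable (leb D)"
      by (intro borel_measurable_add borel_measurable_scaleR borel_measurable_sum borel_measurable_times
          borel_measurable_const g \<phi> \<psi> diag sec2 ZD)
    have \<psi>': "?\<psi> y \<in> borel_measurable (leb D)" if "y \<in> Z" for y
      by (intro borel_measurable_add borel_measurable_scaleR borel_measurable_sum borel_measurable_times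
          borel_measurable_const g \<phi> \<psi> sec1 ZD that)
    have eq1: "fnn_hidden \<kappa> \<Delta> (insert x Z) k g (Suc m) x = ?\<phi> x" if x: "x \<in> D - Z" for x
    proof -
      have "(\<Sum>w\<in>Z. ?w x w *\<^sub>R fnn_hidden \<kappa> \<Delta> (insert x Z) k g m w) = (\<Sum>w\<in>Z. (k (x, w) * \<kappa> * \<Delta>) *\<^sub>R \<psi> w x)"
        using x by (intro sum.cong refl) (auto simp: eq)
      then show ?thesis
        using x Z by (simp add: eq)
    qed
    have eq2: "fnn_hidden \<kappa> \<Delta> (insert x Z) k g (Suc m) y = ?\<psi> y x" if x: "x \<in> D - Z" and y: "y \<in> Z" for x y
    proof -
      have "(\<Sum>w\<in>Z. ?w y w *\<^sub>R fnn_hidden \<kappa> \<Delta> (insert x Z) k g m w) = (\<Sum>w\<in>Z. ?w y w *\<^sub>R \<psi> w x)"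
        using x by (intro sum.cong refl) (simp add: eq)
      moreover have "x \<noteq> y"
        using x y by auto
      ultimately show ?thesis
        using x Z by (simp add: eq)
    qed
    show ?case
      by (rule exI[of _ ?\<phi>], rule exI[of _ ?\<psi>]) (intro conjI ballI \<phi>' \<psi>' eq1 eq2)
  qed
  from this[of m] obtain \<phi> \<psi> where \<phi>: "\<phi> \<in> borel_measurable (leb D)"
    and "\<forall>x\<in>D - Z. fnn_hidden \<kappa> \<Delta> (insert x Z) k g m x = \<phi> x \<and>
         (\<forall>y\<in>Z. fnn_hidden \<kappa> \<Delta> (insert x Z) k g m y = \<psi> y x)"
    by (elim exE conjE)
  then have eq: "\<And>x. x \<in> D - Z \<Longrightarrow> fnn_hidden \<kappa> \<Delta> (insert x Z) k g m x = \<phi> x"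
    by simp
  show ?thesis
  proof (rule measurable_discrete_difference[OF \<phi>, of Z])
    show "countable Z"
      using Z by (simp add: countable_finite)
    show "{x} \<in> sets (leb D)" if "x \<in> Z" for x
      using that Z D by (subst sets_restrict_space_iff) (auto simp: compact_imp_closed)
    show "\<phi> x = fnn_on D \<kappa> (m + 1) Z k g x" if "x \<in> space (leb D)" "x \<notin> Z" for x
    proof -
      have card: "card (insert x Z) = card Z + 1" and x: "x \<in> D - Z"
        using that Z by simp_all
      show ?thesis
        using eq[OF x] by (simp only: fnn_on_eq_hidden[OF m] card \<Delta>_def)
    qed
  qed simp
qed

text \<open>Off the null set \<open>Z\<close> the grid consists of \<open>Z\<close> and the
  evaluation point. This extra node shifts each accumulated error by at most \<open>H l x\<close>,
  which after division by the number of nodes is small in norm by the choice of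
  \<open>Z\<close>.\<close>

lemma fnn_on_approximates_km_iterate:
  fixes g :: "'a::euclidean_space \<Rightarrow> 'b::euclidean_space"
  assumes D: "compact D" and k: "k \<in> L2 (leb2 D)" and bdd: "bounded (k ` (D \<times> D))"
    and g: "g \<in> L2 (leb D)" and m: "1 \<le> m" and \<epsilon>: "0 < \<epsilon>"
  obtains Z where "finite Z" "Z \<subseteq> D" "fnn_on D (1/2) (m + 1) Z k g \<in> L2 (leb D)"
    "L2_norm (leb D) (\<lambda>x. fnn_on D (1/2) (m + 1) Z k g x - km_iterate D k g m x) \<le> \<epsilon>"
proof (cases "measure lborel D = 0")
  case True
  \<comment> \<open>On a domain of volume zero all functions agree almost everywhere and the empty
    base grid serves; the averaging argument needs positive volume.\<close>
  have "emeasure (leb D) (space (leb D)) = 0"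
    using True measure_leb[OF D] finite_measure.emeasure_eq_measure[OF finite_measure_leb[OF D], of D]
    by simp
  then have null: "AE x in leb D. P x" for P
    using sets.top[of "leb D"] by (intro AE_I[of _ _ "space (leb D)"]) auto
  have "fnn_on D (1/2) (m + 1) {} k g \<in> borel_measurable (leb D)"
    by (rule fnn_on_measurable[OF D L2_borel_measurable[OF k] L2_borel_measurable[OF g] _ _ m]) auto
  then have L2: "fnn_on D (1/2) (m + 1) {} k g \<in> L2 (leb D)"
    by (rule L2_cong_AE[OF L2_zero _ null])
  moreover have "L2_norm (leb D) (\<lambda>x. fnn_on D (1/2) (m + 1) {} k g x - km_iterate D k g m x)
      = L2_norm (leb D) (\<lambda>x. 0 :: 'b)"
    by (rule L2_norm_cong_AE[OF L2_borel_measurable[OF L2_diff[OF L2 km_iterate_L2[OF D k g]]] _ null]) simp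
  ultimately show ?thesis
    using \<epsilon> by (intro that[of "{}"]) simp_all
next
  case False
  define V where "V = measure lborel D"
  have V: "V > 0"
    using False measure_nonneg[of lborel D] unfolding V_def by linarith
  obtain B where B: "\<And>x z. x \<in> D \<Longrightarrow> z \<in> D \<Longrightarrow> \<bar>k (x, z)\<bar> \<le> B"
    using bdd by (auto simp: bounded_iff)
  define F where "F = km_iterate D k g"
  have F: "F l \<in> L2 (leb D)" for l
    unfolding F_def by (rule km_iterate_L2[OF D k g])
  define h where "h l = kernel_error D k (F l)" for l
  define H where "H l z = V * B * norm (F l z) + B * (LINT z|leb D. norm (F l z))" for l z
  have h: "error_field D (h l) (H l)" for l
    unfolding h_def H_def V_def by (rule kernel_error_field[OF D k F B])
  then have H: "H l \<in> L2 (leb D)" and h_le: "\<And>z x. z \<in> D \<Longrightarrow> x \<in> D \<Longrightarrow> norm (h l z x) \<le> H l z" for l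
    by (auto simp: error_field_def)
  define Qm where "Qm = (1 + V * \<bar>B\<bar>) ^ m"
  have Qm: "0 \<le> Qm"
    using V by (simp add: Qm_def)
  \<comment> \<open>The sum over the m iterates of the bounds in \<open>E_le\<close>, divided by
    \<eta>. Nothing in it depends on the grid, so \<eta> = \<epsilon> / c can be fixed before the
    nodes are chosen.\<close>
  define c where "c = real m * ((1 + Qm) * 2 + Qm * sqrt V)"
  have c: "0 < c"
    using m Qm V by (auto simp: c_def intro!: mult_pos_pos add_pos_nonneg)
  define \<eta> where "\<eta> = \<epsilon> / c"
  have \<eta>: "0 < \<eta>"
    using \<epsilon> c by (simp add: \<eta>_def)
  obtain Z where Z: "finite Z" "Z \<subseteq> D"
    and Z_le: "\<And>l. l \<in> {..<m} \<Longrightarrow> L2_norm (leb D) (quad_error (h l) Z) \<le> \<eta> * (real (card Z) + 1)"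
      "\<And>l. l \<in> {..<m} \<Longrightarrow> L2_norm (leb D) (H l) \<le> \<eta> * (real (card Z) + 1)"
      "\<And>l. l \<in> {..<m} \<Longrightarrow> (\<Sum>y\<in>Z. norm (quad_error (h l) Z y)) \<le> \<eta> * (real (card Z) + 1)\<^sup>2"
    by (rule exists_accurate_nodes[where h = h and H = H, OF D finite_lessThan[of m] h _ \<eta> that])
      (use V in \<open>simp_all add: V_def\<close>)
  define N where "N = real (card Z) + 1"
  have N: "1 \<le> N"
    by (simp add: N_def)
  let ?f = "fnn_on D (1/2) (m + 1) Z k g"
  \<comment> \<open>A bound for the l-th summand of the network error at x off \<open>Z\<close>. The
    term \<open>Qm * \<eta>\<close> stems from the old nodes: their errors sum to at most \<eta> N^2
    and are divided by N twice, once as quadrature weight and once as mean over the nodes.\<close>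
  define E where "E l x = ((1 + Qm) / N) *\<^sub>R (norm (quad_error (h l) Z x) + H l x) + Qm * \<eta>" for l x
  have e_L2: "(\<lambda>x. norm (quad_error (h l) Z x)) \<in> L2 (leb D)" for l
    by (intro L2_norm_fun quad_error_L2[OF D h Z])
  have E_L2: "E l \<in> L2 (leb D)" for l
    unfolding E_def[abs_def] by (intro L2_add L2_scaleR e_L2 H L2_const finite_measure_leb D)
  have pointwise: "norm (?f x - F m x) \<le> (\<Sum>l<m. E l x)" if x: "x \<in> D" "x \<notin> Z" for x
  proof -
    let ?P = "insert x Z"
    define r where "r l y = norm (quad_error (h l) ?P y) / real (card ?P)" for l y
    have card: "real (card ?P) = N"
      using x Z by (simp add: N_def)
    have qe: "norm (quad_error (h l) ?P y) \<le> norm (quad_error (h l) Z y) + H l x" if "y \<in> ?P" for l y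
    proof -
      have "quad_error (h l) ?P y = quad_error (h l) Z y + h l x y"
        using x Z by (simp add: quad_error_def add.commute)
      also have "norm \<dots> \<le> norm (quad_error (h l) Z y) + H l x"
        using that x Z by (intro order_trans[OF norm_triangle_ineq] add_left_mono h_le) auto
      finally show ?thesis .
    qed
    have "norm (?f x - F m x) = norm (fnn_hidden (1/2) (V / real (card ?P)) ?P k g m x - F m x)"
      by (simp only: fnn_on_eq_hidden[OF m] V_def)
    also have "\<dots> \<le> (\<Sum>l<m. r l x + (1 + V * \<bar>B\<bar>) ^ m * ((\<Sum>y\<in>?P. r l y) / real (card ?P)))"
      unfolding F_def V_def r_def h_def
    proof (rule fnn_hidden_km_iterate_error)
      show "\<bar>k (y, w)\<bar> \<le> \<bar>B\<bar>" if "y \<in> ?P" "w \<in> ?P" for y w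
        using B[of y w] that x Z by force
    qed (use Z in auto)
    also have "\<dots> \<le> (\<Sum>l<m. E l x)"
    proof (rule sum_mono)
      fix l assume l: "l \<in> {..<m}"
      let ?e = "norm (quad_error (h l) Z x)"
      have H0: "0 \<le> H l x"
        using h_le[of x x l] x norm_ge_zero order_trans by blast
      have rx: "r l x \<le> (?e + H l x) / N"
        unfolding r_def card using N by (intro divide_right_mono qe) auto
      have "(\<Sum>y\<in>?P. r l y) \<le> (\<Sum>y\<in>?P. (norm (quad_error (h l) Z y) + H l x) / N)"
        unfolding r_def card using N by (intro sum_mono divide_right_mono qe) auto
      also have "\<dots> = (?e + (\<Sum>y\<in>Z. norm (quad_error (h l) Z y))) / N + H l x"
        using x Z N card by (simp add: sum_divide_distrib[symmetric] sum.distrib field_simps)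
      also have "\<dots> \<le> (?e + \<eta> * N\<^sup>2) / N + H l x"
        using N Z_le(3)[OF l] by (intro add_right_mono divide_right_mono add_left_mono) (auto simp: N_def)
      finally have "(\<Sum>y\<in>?P. r l y) / N \<le> ((?e + \<eta> * N\<^sup>2) / N + H l x) / N"
        using N by (intro divide_right_mono) auto
      also have "\<dots> = ?e / N / N + H l x / N + \<eta>"
        using N by (simp add: field_simps power2_eq_square)
      also have "\<dots> \<le> ?e / N + H l x / N + \<eta>"
        using N divide_right_mono[of "?e" "?e * N" N] by (simp add: divide_le_eq mult_le_cancel_left1)
      finally have avg: "(\<Sum>y\<in>?P. r l y) / N \<le> (?e + H l x) / N + \<eta>"
        by (simp add: add_divide_distrib)
      have "r l x + Qm * ((\<Sum>y\<in>?P. r l y) / N) \<le> (?e + H l x) / N + Qm * ((?e + H l x) / N + \<eta>)"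
        by (intro add_mono rx mult_left_mono avg Qm)
      also have "\<dots> = E l x"
        by (simp add: E_def algebra_simps add_divide_distrib)
      finally show "r l x + (1 + V * \<bar>B\<bar>) ^ m * ((\<Sum>y\<in>?P. r l y) / real (card ?P)) \<le> E l x"
        by (simp only: card Qm_def)
    qed
    finally show ?thesis .
  qed
  have sum_L2: "(\<lambda>x. \<Sum>l<m. E l x) \<in> L2 (leb D)"
    by (intro L2_sum E_L2)
  have f_meas: "?f \<in> borel_measurable (leb D)"
    by (rule fnn_on_measurable[OF D L2_borel_measurable[OF k] L2_borel_measurable[OF g] Z m])
  have "AE z in lborel. z \<notin> Z"
    using finite_imp_null_set_lborel[OF Z(1)] by (rule AE_not_in)
  then have "AE x in leb D. x \<notin> Z"
    using D by (subst AE_restrict_space_iff) (auto simp: compact_imp_closed)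
  with AE_space have AE_le: "AE x in leb D. norm (?f x - F m x) \<le> norm (\<Sum>l<m. E l x)"
  proof eventually_elim
    case (elim x)
    then have "norm (?f x - F m x) \<le> (\<Sum>l<m. E l x)"
      by (intro pointwise) simp_all
    then show ?case
      by simp
  qed
  have diff_meas: "(\<lambda>x. ?f x - F m x) \<in> borel_measurable (leb D)"
    by (intro borel_measurable_diff f_meas L2_borel_measurable[OF F])
  have diff_L2: "(\<lambda>x. ?f x - F m x) \<in> L2 (leb D)"
    by (rule L2_bound[OF sum_L2 diff_meas AE_le])
  have E_le: "L2_norm (leb D) (E l) \<le> \<eta> * ((1 + Qm) * 2 + Qm * sqrt V)" if l: "l \<in> {..<m}" for l
  proof -
    let ?e = "\<lambda>x. norm (quad_error (h l) Z x)"
    have const: "(\<lambda>x. Qm * \<eta>) \<in> L2 (leb D)"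
      by (rule L2_const[OF finite_measure_leb[OF D]])
    have "L2_norm (leb D) (E l) \<le> L2_norm (leb D) (\<lambda>x. ((1 + Qm) / N) *\<^sub>R (?e x + H l x))
        + L2_norm (leb D) (\<lambda>x. Qm * \<eta>)"
      unfolding E_def[abs_def] by (intro L2_norm_triangle L2_scaleR L2_add e_L2 H const)
    also have "L2_norm (leb D) (\<lambda>x. Qm * \<eta>) = Qm * \<eta> * sqrt V"
      using Qm \<eta> measure_leb[OF D] by (simp add: L2_norm_def V_def real_sqrt_mult mult.commute)
    also have "L2_norm (leb D) (\<lambda>x. ((1 + Qm) / N) *\<^sub>R (?e x + H l x))
        = (1 + Qm) / N * L2_norm (leb D) (\<lambda>x. ?e x + H l x)"
      unfolding L2_norm_scaleR using Qm N by simp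
    also have "L2_norm (leb D) (\<lambda>x. ?e x + H l x) \<le> L2_norm (leb D) ?e + L2_norm (leb D) (H l)"
      by (rule L2_norm_triangle[OF e_L2 H])
    also have "\<dots> \<le> \<eta> * N + \<eta> * N"
      unfolding L2_norm_norm N_def by (intro add_mono Z_le l)
    finally have "L2_norm (leb D) (E l) \<le> (1 + Qm) / N * (\<eta> * N + \<eta> * N) + Qm * \<eta> * sqrt V"
      using Qm N by (simp add: mult_left_mono divide_right_mono)
    also have "\<dots> = \<eta> * ((1 + Qm) * 2 + Qm * sqrt V)"
      using N by (simp add: field_simps)
    finally show ?thesis .
  qed
  show ?thesis
  proof (rule that[OF Z])
    show "?f \<in> L2 (leb D)"
      using L2_add[OF diff_L2 F[of m]] by simp
    have "L2_norm (leb D) (\<lambda>x. ?f x - F m x) \<le> L2_norm (leb D) (\<lambda>x. \<Sum>l<m. E l x)"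
      by (rule L2_norm_mono_AE[OF sum_L2 diff_meas AE_le])
    also have "\<dots> \<le> (\<Sum>l<m. L2_norm (leb D) (E l))"
      by (rule L2_norm_sum_le) (simp_all add: E_L2)
    also have "\<dots> \<le> (\<Sum>l<m. \<eta> * ((1 + Qm) * 2 + Qm * sqrt V))"
      by (intro sum_mono E_le)
    also have "\<dots> = \<eta> * c"
      by (simp add: c_def)
    also have "\<dots> = \<epsilon>"
      using c by (simp add: \<eta>_def)
    finally show "L2_norm (leb D) (\<lambda>x. ?f x - km_iterate D k g m x) \<le> \<epsilon>"
      by (simp only: F_def)
  qed
qed

section \<open>Choice of the tolerances and proof of the three claims\<close>

theorem theorem3p1:
  fixes D :: "(real ^ 'd) set"
    and K :: "(real ^ 'd) \<times> (real ^ 'd) \<Rightarrow> real"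
    and S :: "(real ^ 'd \<Rightarrow> real ^ 'd) \<Rightarrow> (real ^ 'd \<Rightarrow> real ^ 'd)"
    and \<Theta> :: "real list set"
    and N :: "real list \<Rightarrow> (real ^ 'd) \<times> (real ^ 'd) \<Rightarrow> real"
    and \<epsilon>1 \<epsilon>2 \<epsilon>3 R :: real
  assumes "compact D"
    and "K \<in> L2 (leb2 D)"
    and "nonexpansive_L2 (leb D)
           (int_op D K :: (real ^ 'd \<Rightarrow> real ^ 'd) \<Rightarrow> (real ^ 'd \<Rightarrow> real ^ 'd))"
    and "solution_operator D K S"
    and "kernel_network_class D \<Theta> N"
    and "\<epsilon>1 > 0" "\<epsilon>2 > 0" "\<epsilon>3 > 0" "R > 0"
  shows "\<exists>\<theta> \<in> \<Theta>.
    (op_norm (leb D)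
       (\<lambda>(u :: real ^ 'd \<Rightarrow> real ^ 'd) x. int_op D K u x - int_op D (N \<theta>) u x) < ennreal \<epsilon>1 \<and>
     (\<exists>S\<^sub>\<theta>. solution_operator D (N \<theta>) S\<^sub>\<theta> \<and>
        (\<forall>g \<in> L2 (leb D). L2_norm (leb D) g \<le> R \<longrightarrow>
           L2_norm (leb D) (\<lambda>x. S g x - S\<^sub>\<theta> g x :: real ^ 'd) < \<epsilon>2)))
    \<and>
    (\<forall>\<rho>. contraction_L2 (leb D) \<rho>
            (int_op D K :: (real ^ 'd \<Rightarrow> real ^ 'd) \<Rightarrow> (real ^ 'd \<Rightarrow> real ^ 'd)) \<longrightarrow>
       (\<exists>\<rho>\<^sub>\<theta>. contraction_L2 (leb D) \<rho>\<^sub>\<theta>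
            (int_op D (N \<theta>) :: (real ^ 'd \<Rightarrow> real ^ 'd) \<Rightarrow> (real ^ 'd \<Rightarrow> real ^ 'd))))
    \<and>
    ((\<forall>\<theta>' \<in> \<Theta>. bounded (N \<theta>' ` (D \<times> D))) \<longrightarrow>
       (\<exists>\<kappa> M. 0 < \<kappa> \<and> \<kappa> \<le> 1 \<and> 2 \<le> M \<and>
          (\<forall>g \<in> L2 (leb D). L2_norm (leb D) g \<le> R \<longrightarrow>
             (\<exists>Z. finite Z \<and> Z \<subseteq> D \<and>
                fnn_on D \<kappa> M Z (N \<theta>) g \<in> L2 (leb D) \<and>
                L2_norm (leb D) (\<lambda>x. S g x - fnn_on D \<kappa> M Z (N \<theta>) g x) < \<epsilon>3))))"
proof -
  note D = assms(1) and K = assms(2) and nonexp = assms(3) and S = assms(4) and net = assms(5)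
    and pos = assms(6-9)
  let ?contr = "\<lambda>\<rho>. contraction_L2 (leb D) \<rho> (int_op D K :: (real ^ 'd \<Rightarrow> real ^ 'd) \<Rightarrow> (real ^ 'd \<Rightarrow> real ^ 'd))"
  obtain q0 where q0: "0 \<le> q0" "q0 < 1"
    and gap0: "\<And>u :: real ^ 'd \<Rightarrow> real ^ 'd. u \<in> L2 (leb D) \<Longrightarrow>
      L2_norm (leb D) (averaged_op D K u) \<le> q0 * L2_norm (leb D) u"
    by (rule averaged_op_gap[OF D K nonexp S that])
  \<comment> \<open>The midpoint between q0 and 1: half of the gap is conceded to the perturbation,
    and q is positive even for q0 = 0, as the geometric estimates require.\<close>
  define q where "q = (1 + q0) / 2"
  have q: "0 < q" "q < 1" and q_eq: "q0 + (1 - q0) / 2 = q"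
    using q0 by (auto simp: q_def field_simps)
  \<comment> \<open>The learned kernel is fixed before a contraction constant is named, so a margin
    is taken beforehand from one such constant: \<beta> is half of 1 - \<rho>, and the learned
    kernel keeps 1 - 2 \<beta> + \<delta> \<le> 1 - \<beta>. If no constant exists, the implication
    is vacuous and \<beta> = 1 is a dummy.\<close>
  obtain \<beta> where \<beta>: "0 < \<beta>" and contr_\<beta>: "\<exists>\<rho>. ?contr \<rho> \<Longrightarrow> ?contr (1 - 2 * \<beta>)"
  proof (cases "\<exists>\<rho>. ?contr \<rho>")
    case True
    then obtain \<rho> where \<rho>: "?contr \<rho>"
      by blast
    have eq: "1 - 2 * ((1 - \<rho>) / 2) = \<rho>"
      by (simp add: field_simps)
    show ?thesis
    proof (rule that)
      show "0 < (1 - \<rho>) / 2"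
        using \<rho> by (simp add: contraction_L2_def)
      show "?contr (1 - 2 * ((1 - \<rho>) / 2))"
        unfolding eq by (rule \<rho>)
    qed
  qed (use that[of 1] in simp)
  \<comment> \<open>Solves \<tau> R / (1 - q)^2 = min \<epsilon>2 (\<epsilon>3 / 2) / 2 for \<tau>.
    The last half makes the bound by \<epsilon>2 strict and leaves at most \<epsilon>3 / 4 for the
    network claim.\<close>
  define \<tau> where "\<tau> = min \<epsilon>2 (\<epsilon>3 / 2) * (1 - q)\<^sup>2 / (2 * R)"
  have \<tau>: "0 < \<tau>"
    using pos q by (simp add: \<tau>_def)
  define \<delta> where "\<delta> = min (min (1 - q0) (\<epsilon>1 / 2)) (min \<beta> \<tau>)"
  have \<delta>: "0 < \<delta>" "\<delta> \<le> 1 - q0" "\<delta> \<le> \<epsilon>1 / 2" "\<delta> \<le> \<beta>" "\<delta> \<le> \<tau>"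
    unfolding \<delta>_def using q0 pos \<beta> \<tau> by linarith+
  obtain \<theta> where \<theta>: "\<theta> \<in> \<Theta>" and "L2_norm (leb2 D) (\<lambda>p. K p - N \<theta> p) < \<delta>"
    using net K \<delta>(1) unfolding kernel_network_class_def by blast
  then have close: "L2_norm (leb2 D) (\<lambda>p. K p - N \<theta> p) \<le> \<delta>"
    by simp
  have k: "N \<theta> \<in> L2 (leb2 D)"
    using net \<theta> unfolding kernel_network_class_def by blast
  have gap: "L2_norm (leb D) (averaged_op D (N \<theta>) u) \<le> q * L2_norm (leb D) u"
    if u: "u \<in> L2 (leb D)" for u :: "real ^ 'd \<Rightarrow> real ^ 'd"
  proof -
    have "L2_norm (leb D) (averaged_op D (N \<theta>) u) \<le> (q0 + \<delta> / 2) * L2_norm (leb D) u"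
      by (rule averaged_op_perturb[OF D K k close gap0[OF u] u])
    also have "\<dots> \<le> q * L2_norm (leb D) u"
      using \<delta>(2) by (intro mult_right_mono) (simp_all flip: q_eq)
    finally show ?thesis .
  qed
  have gapK: "L2_norm (leb D) (averaged_op D K u) \<le> q * L2_norm (leb D) u"
    if u: "u \<in> L2 (leb D)" for u :: "real ^ 'd \<Rightarrow> real ^ 'd"
    by (rule order_trans[OF gap0[OF u] mult_right_mono]) (use q0 in \<open>simp_all add: q_def\<close>)
  obtain S\<^sub>\<theta> :: "(real ^ 'd \<Rightarrow> real ^ 'd) \<Rightarrow> (real ^ 'd \<Rightarrow> real ^ 'd)"
    where S\<theta>: "solution_operator D (N \<theta>) S\<^sub>\<theta>"
      and S\<theta>_km: "\<And>g n. g \<in> L2 (leb D) \<Longrightarrow>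
        L2_norm (leb D) (\<lambda>x. S\<^sub>\<theta> g x - km_iterate D (N \<theta>) g n x) \<le> L2_norm (leb D) g * q ^ n / (1 - q)"
    by (rule solution_operator_exists[OF D k q gap that])
  have sol: "S g \<in> L2 (leb D)" "S\<^sub>\<theta> g \<in> L2 (leb D)" if "g \<in> L2 (leb D)" for g
    using S S\<theta> that by (simp_all add: solution_operator_def)
  have S_close: "L2_norm (leb D) (\<lambda>x. S g x - S\<^sub>\<theta> g x) \<le> min \<epsilon>2 (\<epsilon>3 / 2) / 2"
    if g: "g \<in> L2 (leb D)" and gR: "L2_norm (leb D) g \<le> R" for g
  proof -
    have "L2_norm (leb D) (\<lambda>x. S g x - S\<^sub>\<theta> g x) \<le> \<delta> * L2_norm (leb D) g / (1 - q)\<^sup>2"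
      using S S\<theta> g
      by (intro solution_stability[OF D K k close q(2) gapK[OF sol(1)[OF g]] gap g sol(1)[OF g] sol(2)[OF g]])
        (simp_all add: solution_operator_def)
    also have "\<dots> \<le> \<tau> * R / (1 - q)\<^sup>2"
      using \<delta> \<tau> gR by (intro divide_right_mono mult_mono) auto
    also have "\<dots> = min \<epsilon>2 (\<epsilon>3 / 2) / 2"
      using pos q by (simp add: \<tau>_def)
    finally show ?thesis .
  qed
  \<comment> \<open>The depth depends on R but not on g. It is at least 1 so that the network has M
    = m + 1 \<ge> 2 layers; passing to the successor of n secures this.\<close>
  obtain m where m: "q ^ m < \<epsilon>3 / 4 * (1 - q) / R" "1 \<le> m"
  proof -
    obtain n where n: "q ^ n < \<epsilon>3 / 4 * (1 - q) / R"
      using real_arch_pow_inv[of "\<epsilon>3 / 4 * (1 - q) / R" q] pos q by auto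
    have "q ^ Suc n \<le> q ^ n"
      using q by (simp add: mult_left_le_one_le)
    with n show ?thesis
      by (intro that[of "Suc n"]) auto
  qed
  show ?thesis
  proof (intro bexI[OF _ \<theta>] conjI allI impI)
    have "op_norm (leb D) (\<lambda>(u :: real ^ 'd \<Rightarrow> real ^ 'd) x. int_op D K u x - int_op D (N \<theta>) u x) \<le> ennreal \<delta>"
      by (rule op_norm_int_op_diff_le[OF D K k close])
    also have "\<dots> < ennreal \<epsilon>1"
      using \<delta> pos by (intro ennreal_lessI) auto
    finally show "op_norm (leb D) (\<lambda>(u :: real ^ 'd \<Rightarrow> real ^ 'd) x. int_op D K u x - int_op D (N \<theta>) u x)
        < ennreal \<epsilon>1" .
  next
    have "L2_norm (leb D) (\<lambda>x. S g x - S\<^sub>\<theta> g x) < \<epsilon>2"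
      if "g \<in> L2 (leb D)" "L2_norm (leb D) g \<le> R" for g
      using S_close[OF that] pos by linarith
    then show "\<exists>S\<^sub>\<theta>. solution_operator D (N \<theta>) S\<^sub>\<theta> \<and> (\<forall>g \<in> L2 (leb D). L2_norm (leb D) g \<le> R \<longrightarrow>
           L2_norm (leb D) (\<lambda>x. S g x - S\<^sub>\<theta> g x :: real ^ 'd) < \<epsilon>2)"
      using S\<theta> by blast
  next
    fix \<rho> assume "?contr \<rho>"
    then have contr: "?contr (1 - 2 * \<beta>)"
      using contr_\<beta> by blast
    have "lipschitz_L2 (leb D) (1 - 2 * \<beta> + \<delta>)
        (int_op D (N \<theta>) :: (real ^ 'd \<Rightarrow> real ^ 'd) \<Rightarrow> (real ^ 'd \<Rightarrow> real ^ 'd))"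
      by (rule lipschitz_int_op_perturb[OF D K k close]) (use contr in \<open>simp add: contraction_L2_def\<close>)
    then show "\<exists>\<rho>\<^sub>\<theta>. contraction_L2 (leb D) \<rho>\<^sub>\<theta>
        (int_op D (N \<theta>) :: (real ^ 'd \<Rightarrow> real ^ 'd) \<Rightarrow> (real ^ 'd \<Rightarrow> real ^ 'd))"
      using \<beta> \<delta> by (intro exI[of _ "1 - 2 * \<beta> + \<delta>"]) (simp add: contraction_L2_def)
  next
    assume "\<forall>\<theta>' \<in> \<Theta>. bounded (N \<theta>' ` (D \<times> D))"
    then have bdd: "bounded (N \<theta> ` (D \<times> D))"
      using \<theta> by blast
    show "\<exists>\<kappa> M. 0 < \<kappa> \<and> \<kappa> \<le> 1 \<and> 2 \<le> M \<and>
          (\<forall>g \<in> L2 (leb D). L2_norm (leb D) g \<le> R \<longrightarrow>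
             (\<exists>Z. finite Z \<and> Z \<subseteq> D \<and> fnn_on D \<kappa> M Z (N \<theta>) g \<in> L2 (leb D) \<and>
                L2_norm (leb D) (\<lambda>x. S g x - fnn_on D \<kappa> M Z (N \<theta>) g x) < \<epsilon>3))"
    proof (rule exI[of _ "1/2"], rule exI[of _ "m + 1"], intro conjI ballI impI)
      fix g :: "real ^ 'd \<Rightarrow> real ^ 'd"
      assume g: "g \<in> L2 (leb D)" and gR: "L2_norm (leb D) g \<le> R"
      obtain Z where Z: "finite Z" "Z \<subseteq> D"
        and f: "fnn_on D (1/2) (m + 1) Z (N \<theta>) g \<in> L2 (leb D)"
        and f_le: "L2_norm (leb D) (\<lambda>x. fnn_on D (1/2) (m + 1) Z (N \<theta>) g x - km_iterate D (N \<theta>) g m x) \<le> \<epsilon>3 / 4"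
        using fnn_on_approximates_km_iterate[OF D k bdd g m(2), of "\<epsilon>3 / 4"] pos by auto
      note F = km_iterate_L2[OF D k g, of m]
      have "L2_norm (leb D) (\<lambda>x. S\<^sub>\<theta> g x - km_iterate D (N \<theta>) g m x) \<le> L2_norm (leb D) g * q ^ m / (1 - q)"
        by (rule S\<theta>_km[OF g])
      also have "\<dots> \<le> R * q ^ m / (1 - q)"
        using gR q by (intro divide_right_mono mult_right_mono) auto
      also have "\<dots> < \<epsilon>3 / 4"
        using m(1) pos q by (simp add: field_simps)
      finally have km: "L2_norm (leb D) (\<lambda>x. S\<^sub>\<theta> g x - km_iterate D (N \<theta>) g m x) < \<epsilon>3 / 4" .
      \<comment> \<open>Replacing the kernel, truncating the iteration and discretising the
        integrals cost at most \<epsilon>3 / 4 each.\<close>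
      have "L2_norm (leb D) (\<lambda>x. S g x - fnn_on D (1/2) (m + 1) Z (N \<theta>) g x) < \<epsilon>3"
        using L2_norm_triangle_diff[OF sol(1)[OF g] sol(2)[OF g] f]
          L2_norm_triangle_diff[OF sol(2)[OF g] F f] S_close[OF g gR] km f_le pos
        unfolding L2_norm_minus_commute[of _ "km_iterate D (N \<theta>) g m"] by linarith
      then show "\<exists>Z. finite Z \<and> Z \<subseteq> D \<and> fnn_on D (1/2) (m + 1) Z (N \<theta>) g \<in> L2 (leb D) \<and>
                L2_norm (leb D) (\<lambda>x. S g x - fnn_on D (1/2) (m + 1) Z (N \<theta>) g x) < \<epsilon>3"
        using Z f by blast
    qed (use m in simp_all)
  qed
qed

end
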